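(* Let $\sigma_1>0$, $\sigma_1\neq1$. Let $E\subset\mathbb{R}^2\cong\mathbb{C}$ be an inclusion generated by a function $f$ as described in the context, with associated map $z(h)$. Let $\gamma_1\in\mathbb{R}\setminus\{0\}$ and $\gamma_2\in\mathbb{C}$ with $\operatorname{Im}\gamma_2=1-\gamma_1$, and put $z'(h)=\gamma_1z(h)+\gamma_2h$. Then $z'$ is an analytic function of $h=v+iw$ in a neighbourhood of the slit $[-1,1]$ (with the slit removed), whose boundary values on both sides of the slit satisfy $\operatorname{Im}z'=v$, and the inclusion $E'$ with boundary $$\partial E'=\{(x',y'):\ x'=\gamma_1x+\operatorname{Re}(\gamma_2)\,y,\ y'=y,\ (x,y)\in\partial E\}$$ again has a constant field inside for a suitable body and boundary condition: there exist a simply connected bounded open set $\Omega'\supset\overline{E'}$ and a solution $V$ of the conductivity equation $\nabla\cdot(\sigma\nabla V)=0$ in $\Omega'$, with $\sigma=\sigma_1$ in $E'$ and $\sigma=1$ in $\Omega'\setminus\overline{E'}$, such that $V(x',y')=x'$ in $E'$. In other words, these inclusions remain $E_\Omega$-inclusions under shears and stretches of this form.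
   Context: An $E_\Omega$-inclusion is an inclusion $E$ (simply connected, lying strictly inside a simply connected body $\Omega$) of conductivity $\sigma_1$ in a matrix of conductivity $1$ occupying $\Omega\setminus E$, such that for an appropriate boundary condition on $\partial\Omega$ the field inside $E$ is constant, with coordinates chosen so that the potential is $V=x$ in $E$. Inclusions generated by $f$: let $f$ be holomorphic in a neighbourhood of $\mathbb{R}\cup\{\infty\}$ in the Riemann sphere, with $f(\overline{t})=\overline{f(t)}$, such that $f(t)\ne f(-t)$ for all real $t\ne0$, $f'(0)\ne0$, and $f(t)=\beta_0+\beta_1/t+O(|t|^{-2})$ as $|t|\to\infty$ with $\beta_1$ real and positive. For $h=v+iw$ near the slit $\{w=0,-1\le v\le1\}$ and off the slit, put $t=\sqrt{(1-h)/(1+h)}$, with the branch of the square root having its cut on the positive real axis, so that $\operatorname{Im}t>0$, and $z(h)=x+iy=ih+f(t)$. The function $z(h)$ is analytic near (and off) the slit, with $y=v$ on both sides of the slit. The generated inclusion $E$ is the bounded domain whose boundary is the image of the two sides of the slit, i.e. the Jordan curve $x=f\left(\pm\sqrt{(1-y)/(1+y)}\right)$, $-1\le y\le1$ (equivalently $x=f(t)$, $y=(1-t^2)/(1+t^2)$, $t\in\mathbb{R}\cup\{\infty\}$). *)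

theory Defs
  imports "HOL-Complex_Analysis.Complex_Analysis" "HOL-Library.Landau_Symbols"
begin

text \<open>The plane is identified with the type of complex numbers, \<open>(x, y)\<close> being \<open>x + \<i>y\<close>;
  the gradient of a real-valued function is the complex number \<open>\<phi>\<^sub>x + \<i>\<phi>\<^sub>y\<close>, so that
  the dot product of two gradients is \<open>\<bullet>\<close>.\<close>

definition grad :: "(complex \<Rightarrow> real) \<Rightarrow> complex \<Rightarrow> complex" where
  "grad \<phi> z = Complex (frechet_derivative \<phi> (at z) 1) (frechet_derivative \<phi> (at z) \<i>)"

primrec C_k :: "nat \<Rightarrow> (complex \<Rightarrow> real) \<Rightarrow> bool" where
  "C_k 0 \<phi> \<longleftrightarrow> continuous_on UNIV \<phi>"
| "C_k (Suc k) \<phi> \<longleftrightarrow>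
     (\<forall>z. \<phi> differentiable (at z)) \<and> C_k k (\<lambda>z. Re (grad \<phi> z)) \<and> C_k k (\<lambda>z. Im (grad \<phi> z))"

definition test_function :: "complex set \<Rightarrow> (complex \<Rightarrow> real) \<Rightarrow> bool" where
  "test_function \<Omega> \<phi> \<longleftrightarrow>
     (\<forall>k. C_k k \<phi>) \<and> compact (closure {z. \<phi> z \<noteq> 0}) \<and> closure {z. \<phi> z \<noteq> 0} \<subseteq> \<Omega>"

definition square_integrable :: "complex set \<Rightarrow> (complex \<Rightarrow> 'b::euclidean_space) \<Rightarrow> bool" where
  "square_integrable \<Omega> F \<longleftrightarrow>
     F \<in> borel_measurable (lebesgue_on \<Omega>) \<and> integrable (lebesgue_on \<Omega>) (\<lambda>z. (norm (F z))\<^sup>2)"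

definition weak_gradient :: "complex set \<Rightarrow> (complex \<Rightarrow> real) \<Rightarrow> (complex \<Rightarrow> complex) \<Rightarrow> bool" where
  "weak_gradient \<Omega> V G \<longleftrightarrow>
     (\<forall>\<phi>. test_function \<Omega> \<phi> \<longrightarrow>
        integral\<^sup>L (lebesgue_on \<Omega>) (\<lambda>z. V z *\<^sub>R grad \<phi> z)
          = - integral\<^sup>L (lebesgue_on \<Omega>) (\<lambda>z. \<phi> z *\<^sub>R G z))"

text \<open>For discontinuous \<open>\<sigma>\<close> the equation \<open>\<nabla>\<cdot>(\<sigma>\<nabla>V) = 0\<close> has its usual weak meaning:
  \<open>V\<close> lies in the Sobolev space \<open>H\<^sup>1(\<Omega>)\<close>, and \<open>\<sigma>\<nabla>V\<close> is divergence free in the sense of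
  distributions.\<close>

definition conductivity_solution ::
    "complex set \<Rightarrow> (complex \<Rightarrow> real) \<Rightarrow> (complex \<Rightarrow> real) \<Rightarrow> bool" where
  "conductivity_solution \<Omega> \<sigma> V \<longleftrightarrow>
     square_integrable \<Omega> V \<and>
     (\<exists>G. square_integrable \<Omega> G \<and> weak_gradient \<Omega> V G \<and>
       (\<forall>\<phi>. test_function \<Omega> \<phi> \<longrightarrow>
          integral\<^sup>L (lebesgue_on \<Omega>) (\<lambda>z. \<sigma> z * (G z \<bullet> grad \<phi> z)) = 0))"

definition E_Omega_inclusion :: "real \<Rightarrow> complex set \<Rightarrow> bool" where
  "E_Omega_inclusion \<sigma>\<^sub>1 E \<longleftrightarrow>
     open E \<and> E \<noteq> {} \<and> simply_connected E \<and>
     (\<exists>\<Omega>. open \<Omega> \<and> bounded \<Omega> \<and> simply_connected \<Omega> \<and> closure E \<subseteq> \<Omega> \<and>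
       (\<exists>V. conductivity_solution \<Omega> (\<lambda>z. if z \<in> E then \<sigma>\<^sub>1 else 1) V \<and> (\<forall>z\<in>E. V z = Re z)))"

text \<open>A neighbourhood of \<open>\<real> \<union> {\<infinity>}\<close> in the Riemann sphere, with \<open>\<infinity>\<close> removed, is an open set
  \<open>U \<supseteq> \<real>\<close> containing all points of sufficiently large modulus; holomorphy of \<open>f\<close> at \<open>\<infinity>\<close>
  itself follows from the expansion there, with \<open>f(\<infinity>) = \<beta>\<^sub>0\<close>. Taking \<open>U\<close> symmetric under
  conjugation loses nothing, since \<open>U\<close> may be replaced by its intersection with its mirror image.\<close>

definition generating_function :: "(complex \<Rightarrow> complex) \<Rightarrow> complex \<Rightarrow> real \<Rightarrow> bool" where
  "generating_function f \<beta>\<^sub>0 \<beta>\<^sub>1 \<longleftrightarrow>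
     (\<exists>U. open U \<and> \<real> \<subseteq> U \<and> (\<forall>\<^sub>F t in at_infinity. t \<in> U) \<and> f holomorphic_on U \<and>
        (\<forall>t\<in>U. cnj t \<in> U \<and> f (cnj t) = cnj (f t))) \<and>
     (\<forall>t::real. t \<noteq> 0 \<longrightarrow> f (of_real t) \<noteq> f (of_real (- t))) \<and>
     deriv f 0 \<noteq> 0 \<and>
     (\<lambda>t. f t - (\<beta>\<^sub>0 + of_real \<beta>\<^sub>1 / t)) \<in> O[at_infinity](\<lambda>t. 1 / t\<^sup>2) \<and>
     \<beta>\<^sub>1 > 0"

text \<open>The last point is the one for \<open>t = \<infinity>\<close>. Both \<open>f t\<close> for real \<open>t\<close> and \<open>\<beta>\<^sub>0\<close> are real for a
  generating function.\<close>

definition generated_curve :: "(complex \<Rightarrow> complex) \<Rightarrow> complex \<Rightarrow> complex set" where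
  "generated_curve f \<beta>\<^sub>0 =
     range (\<lambda>t::real. Complex (Re (f (of_real t))) ((1 - t\<^sup>2) / (1 + t\<^sup>2)))
       \<union> {Complex (Re \<beta>\<^sub>0) (- 1)}"

definition generated_inclusion :: "(complex \<Rightarrow> complex) \<Rightarrow> complex \<Rightarrow> complex set" where
  "generated_inclusion f \<beta>\<^sub>0 = inside (generated_curve f \<beta>\<^sub>0)"

definition slit :: "complex set" where
  "slit = complex_of_real ` {-1..1}"

text \<open>The square root with cut on the positive real axis and positive imaginary part is
  \<open>\<i> * csqrt (- w)\<close>, as \<open>csqrt\<close> has its cut on the negative axis and nonnegative real part.\<close>

definition t_map :: "complex \<Rightarrow> complex" where
  "t_map h = \<i> * csqrt (- ((1 - h) / (1 + h)))"

definition z_map :: "(complex \<Rightarrow> complex) \<Rightarrow> complex \<Rightarrow> complex" where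
  "z_map f h = \<i> * h + f (t_map h)"

definition analytic_off_slit :: "(complex \<Rightarrow> complex) \<Rightarrow> bool" where
  "analytic_off_slit g \<longleftrightarrow> (\<exists>N. open N \<and> slit \<subseteq> N \<and> g analytic_on (N - slit))"

definition boundary_values_Im_eq_v :: "(complex \<Rightarrow> complex) \<Rightarrow> bool" where
  "boundary_values_Im_eq_v g \<longleftrightarrow>
     (\<forall>v\<in>{-1..1::real}.
        (\<exists>L. (g \<longlongrightarrow> L) (at (of_real v) within {h. Im h > 0}) \<and> Im L = v) \<and>
        (\<exists>L. (g \<longlongrightarrow> L) (at (of_real v) within {h. Im h < 0}) \<and> Im L = v))"

end

(* Proof idea. Substitute t = i(1 - zeta)/(1 + zeta), so that the real line together with infinity
   becomes the unit circle and y = (1 - t^2)/(1 + t^2) becomes Re zeta = (zeta + 1/zeta)/2. The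
   boundary of E' is then the injective image of the circle under
   Z = gamma1 f + Re(gamma2) y + i y, which is holomorphic with nonzero derivative near the circle.
   Hence h = y o Z^(-1) is holomorphic on a two-sided neighbourhood of the boundary of E' and
   equals Im z on it; no orientation is involved, so the sign of gamma1 plays no role.
   Put W = z + i(sigma1 - 1)h outside E' and V = x, U = sigma1 y inside, V = Re W, U = Im W outside.
   Both V and U are continuous, and grad U is sigma grad V turned by a right angle. Every
   horizontal or vertical line meets the boundary in finitely many points, so integration along
   lines shows that the piecewise gradients are weak gradients; testing sigma grad V against
   grad phi then gives the integral of U times (phi_yx - phi_xy), which vanishes. *)
theory Submission
  imports Defs
begin

text \<open>On the curve h equals y, so W = x + i sigma1 y there: the factor sigma1 - 1 is what
  makes both the potential and the flux function U match. W exists only where h does, so the body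
  has to be a simply connected set consisting of the inclusion and a thin collar; finding it is a
  question of planar topology, answered through connected complements. Integration along lines takes
  the place of Green's formula on the two sides, so traces and boundary integrals never appear. A
  horizontal line meets the curve in at most two points; for vertical lines finiteness comes from
  the isolated zeros of a nonconstant holomorphic function on an annulus. The hypotheses on f enter
  through Z. Circle points of equal height are conjugate, and conjugation is t -> -t, so f(t)
  differing from f(-t) makes Z injective. Along the circle the derivative of y vanishes only at zeta
  = 1 and zeta = -1, that is t = 0 and t = infinity, where f'(0) and beta1 keep the derivative of Z
  from vanishing.\<close>

section \<open>Weak solutions of the conductivity equation\<close>

text \<open>Makes Fubini's theorem available in the plane. Lebesgue measure is determined by its
  values on boxes, and \<open>Complex\<close> carries rectangles to boxes of the same area.\<close>

lemma lborel_complex: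
  "(lborel :: complex measure) = distr (lborel \<Otimes>\<^sub>M lborel) borel (\<lambda>(x, y). Complex x y)"
proof (rule lborel_eqI)
  have meas: "(\<lambda>(x, y). Complex x y) \<in> measurable (lborel \<Otimes>\<^sub>M lborel) borel"
    by (auto simp: lborel_prod case_prod_beta intro!: borel_measurable_continuous_onI continuous_intros)
  fix l u :: complex
  assume le: "\<And>b. b \<in> Basis \<Longrightarrow> l \<bullet> b \<le> u \<bullet> b"
  have "(\<lambda>(x, y). Complex x y) -` box l u \<inter> space (lborel \<Otimes>\<^sub>M lborel)
      = {Re l<..<Re u} \<times> {Im l<..<Im u}"
    by (auto simp: space_pair_measure box_def Basis_complex_def)
  then have "emeasure (distr (lborel \<Otimes>\<^sub>M lborel) borel (\<lambda>(x, y). Complex x y)) (box l u)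
      = emeasure (lborel \<Otimes>\<^sub>M lborel) ({Re l<..<Re u} \<times> {Im l<..<Im u})"
    using meas by (simp add: emeasure_distr)
  also have "\<dots> = ennreal ((Re u - Re l) * (Im u - Im l))"
    using le[of 1] le[of \<i>]
    by (simp add: lborel.emeasure_pair_measure_Times Basis_complex_def ennreal_mult)
  also have "(Re u - Re l) * (Im u - Im l) = (\<Prod>b\<in>Basis. (u - l) \<bullet> b)"
    by (simp add: Basis_complex_def)
  finally show "emeasure (distr (lborel \<Otimes>\<^sub>M lborel) borel (\<lambda>(x, y). Complex x y)) (box l u)
      = (\<Prod>b\<in>Basis. (u - l) \<bullet> b)" .
qed simp

lemma
  fixes g :: "complex \<Rightarrow> real"
  assumes g: "integrable lborel g"
  shows integral_complex_eq_0_horizontal: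
      "(\<And>y. integral\<^sup>L lborel (\<lambda>x. g (Complex x y)) = 0) \<Longrightarrow> integral\<^sup>L lborel g = 0"
    and integral_complex_eq_0_vertical:
      "(\<And>x. integral\<^sup>L lborel (\<lambda>y. g (Complex x y)) = 0) \<Longrightarrow> integral\<^sup>L lborel g = 0"
proof -
  have meas: "(\<lambda>(x, y). Complex x y) \<in> measurable (lborel \<Otimes>\<^sub>M lborel) borel"
    by (auto simp: lborel_prod case_prod_beta intro!: borel_measurable_continuous_onI continuous_intros)
  have gm: "g \<in> borel_measurable borel"
    using borel_measurable_integrable[OF g] by simp
  have int: "integrable (lborel \<Otimes>\<^sub>M lborel) (\<lambda>(x, y). g (Complex x y))"
    using g integrable_distr_eq[OF meas gm] unfolding lborel_complex by (simp add: case_prod_beta split_beta')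
  have eq: "integral\<^sup>L lborel g = integral\<^sup>L (lborel \<Otimes>\<^sub>M lborel) (\<lambda>(x, y). g (Complex x y))"
    using integral_distr[OF meas gm] unfolding lborel_complex by (simp add: case_prod_beta split_beta')
  show "integral\<^sup>L lborel g = 0" if "\<And>y. integral\<^sup>L lborel (\<lambda>x. g (Complex x y)) = 0"
    using lborel_pair.integral_snd[OF int] that eq by simp
  show "integral\<^sup>L lborel g = 0" if "\<And>x. integral\<^sup>L lborel (\<lambda>y. g (Complex x y)) = 0"
    using lborel_pair.integral_fst[OF int] that eq by simp
qed

text \<open>The fundamental theorem of calculus tolerates finitely many exceptional points as long
  as \<open>F\<close> is continuous across them; both end values vanish.\<close>

lemma integral_derivative_eq_0:
  fixes F g :: "real \<Rightarrow> real"
  assumes "continuous_on UNIV F" "finite S"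
    and "\<And>x. x \<notin> S \<Longrightarrow> (F has_vector_derivative g x) (at x)"
    and F0: "\<And>x. \<bar>x\<bar> \<ge> R \<Longrightarrow> F x = 0" and g0: "\<And>x. \<bar>x\<bar> \<ge> R \<Longrightarrow> g x = 0"
  shows "integral\<^sup>L lborel g = 0"
proof (cases "integrable lborel g")
  case True
  \<comment> \<open>\<open>R\<close> may be negative; the maximum keeps the interval of integration
    nonempty.\<close>
  let ?R = "max R 0"
  have "(g has_integral (F ?R - F (- ?R))) {- ?R..?R}"
    using assms by (intro fundamental_theorem_of_calculus_strong[where S = S])
      (auto intro: continuous_on_subset)
  moreover have "F ?R = 0" "F (- ?R) = 0"
    by (auto intro!: F0)
  ultimately have "(g has_integral 0) {- ?R..?R}"
    by simp
  then have "(g has_integral 0) UNIV"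
    by (rule has_integral_on_superset) (auto intro!: g0)
  then show ?thesis
    using has_integral_unique has_integral_integral_lborel[OF True] by blast
next
  \<comment> \<open>The Bochner integral of a non-integrable function is 0 by convention. This lets
    every line be treated alike, although Fubini yields integrability only on almost every
    line.\<close>
  case False
  then show ?thesis
    by (rule not_integrable_integral_eq)
qed

lemma has_derivative_horizontal_line:
  assumes "(F has_derivative (\<lambda>w. G \<bullet> w)) (at (Complex x y))"
  shows "((\<lambda>x. F (Complex x y)) has_real_derivative Re G) (at x)"
proof -
  have "((\<lambda>x. Complex x y) has_derivative (\<lambda>h. of_real h)) (at x)"
    unfolding Complex_eq by (auto intro!: derivative_eq_intros)
  from has_derivative_compose[OF this assms] show ?thesis
    by (simp add: has_field_derivative_def inner_complex_def)
qed

lemma has_derivative_vertical_line: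
  assumes "(F has_derivative (\<lambda>w. G \<bullet> w)) (at (Complex x y))"
  shows "((\<lambda>y. F (Complex x y)) has_real_derivative Im G) (at y)"
proof -
  have "((\<lambda>y. Complex x y) has_derivative (\<lambda>h. \<i> * of_real h)) (at y)"
    unfolding Complex_eq by (auto intro!: derivative_eq_intros)
  from has_derivative_compose[OF this assms] show ?thesis
    by (simp add: has_field_derivative_def inner_complex_def)
qed

text \<open>The real part of \<open>G\<close> is the derivative of \<open>F\<close> along horizontal
  lines and the imaginary part the one along vertical lines, so Fubini in the suitable order reduces
  each to the one-dimensional case.\<close>

lemma integral_gradient_eq_0:
  fixes F :: "complex \<Rightarrow> real" and G :: "complex \<Rightarrow> complex"
  assumes cont: "continuous_on UNIV F"
    and der: "\<And>z. z \<notin> C \<Longrightarrow> (F has_derivative (\<lambda>w. G z \<bullet> w)) (at z)"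
    and int: "integrable lborel G"
    and F0: "\<And>z. cmod z \<ge> R \<Longrightarrow> F z = 0" and G0: "\<And>z. cmod z \<ge> R \<Longrightarrow> G z = 0"
    and finx: "\<And>y. finite {x. Complex x y \<in> C}" and finy: "\<And>x. finite {y. Complex x y \<in> C}"
  shows "integral\<^sup>L lborel G = 0"
proof -
  have "integral\<^sup>L lborel (\<lambda>z. Re (G z)) = 0"
  proof (rule integral_complex_eq_0_horizontal)
    fix y
    have "((\<lambda>x. F (Complex x y)) has_vector_derivative Re (G (Complex x y))) (at x)"
      if "x \<notin> {x. Complex x y \<in> C}" for x
      using has_derivative_horizontal_line[OF der] that
      by (simp flip: has_real_derivative_iff_has_vector_derivative)
    moreover have "cmod (Complex x y) \<ge> R" if "\<bar>x\<bar> \<ge> R" for x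
      using abs_Re_le_cmod[of "Complex x y"] that by simp
    moreover have "continuous_on UNIV (\<lambda>x. F (Complex x y))"
      by (rule continuous_on_compose2[OF cont]) (auto intro!: continuous_intros)
    ultimately show "integral\<^sup>L lborel (\<lambda>x. Re (G (Complex x y))) = 0"
      by (intro integral_derivative_eq_0[OF _ finx[of y], where R = R and F = "\<lambda>x. F (Complex x y)"])
        (auto simp: F0 G0)
  qed (use int in simp)
  moreover have "integral\<^sup>L lborel (\<lambda>z. Im (G z)) = 0"
  proof (rule integral_complex_eq_0_vertical)
    fix x
    have "((\<lambda>y. F (Complex x y)) has_vector_derivative Im (G (Complex x y))) (at y)"
      if "y \<notin> {y. Complex x y \<in> C}" for y
      using has_derivative_vertical_line[OF der] that
      by (simp flip: has_real_derivative_iff_has_vector_derivative)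
    moreover have "cmod (Complex x y) \<ge> R" if "\<bar>y\<bar> \<ge> R" for y
      using abs_Im_le_cmod[of "Complex x y"] that by simp
    moreover have "continuous_on UNIV (\<lambda>y. F (Complex x y))"
      by (rule continuous_on_compose2[OF cont]) (auto intro!: continuous_intros)
    ultimately show "integral\<^sup>L lborel (\<lambda>y. Im (G (Complex x y))) = 0"
      by (intro integral_derivative_eq_0[OF _ finy[of x], where R = R and F = "\<lambda>y. F (Complex x y)"])
        (auto simp: F0 G0)
  qed (use int in simp)
  ultimately show ?thesis
    using int by (simp add: complex_eq_iff)
qed

section \<open>Test functions and their gradients\<close>

lemma grad_has_derivative:
  assumes "\<phi> differentiable (at z)"
  shows "(\<phi> has_derivative (\<lambda>w. grad \<phi> z \<bullet> w)) (at z)"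
proof -
  have der: "(\<phi> has_derivative frechet_derivative \<phi> (at z)) (at z)"
    using assms frechet_derivative_works by blast
  then interpret linear "frechet_derivative \<phi> (at z)"
    by (rule has_derivative_linear)
  have "frechet_derivative \<phi> (at z) w = grad \<phi> z \<bullet> w" for w
  proof -
    have "w = Re w *\<^sub>R 1 + Im w *\<^sub>R \<i>"
      by (simp add: complex_eq_iff)
    then have "frechet_derivative \<phi> (at z) w = frechet_derivative \<phi> (at z) (Re w *\<^sub>R 1 + Im w *\<^sub>R \<i>)"
      by simp
    also have "\<dots> = grad \<phi> z \<bullet> w"
      by (simp only: add scale) (simp add: grad_def inner_complex_def)
    finally show ?thesis .
  qed
  then show ?thesis
    using der by presburger
qed

lemma grad_eqI:
  assumes "(\<phi> has_derivative (\<lambda>w. a \<bullet> w)) (at z)"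
  shows "grad \<phi> z = a"
  using frechet_derivative_at[OF assms] unfolding grad_def
  by (metis complex_inner_1_right complex_inner_i_right complex_surj)

lemma C_k_continuous: "C_k k \<phi> \<Longrightarrow> continuous_on UNIV \<phi>"
  by (cases k) (auto intro!: differentiable_imp_continuous_on simp: differentiable_on_def)

context
  fixes \<Omega> :: "complex set" and \<phi> :: "complex \<Rightarrow> real"
  assumes test: "test_function \<Omega> \<phi>"
begin

lemma test_function_differentiable: "\<phi> differentiable (at z)"
  using test C_k.simps(2) unfolding test_function_def by blast

lemma test_function_has_derivative: "(\<phi> has_derivative (\<lambda>w. grad \<phi> z \<bullet> w)) (at z)"
  by (rule grad_has_derivative[OF test_function_differentiable])

lemma test_function_continuous: "continuous_on UNIV \<phi>"
  using test unfolding test_function_def by (meson C_k_continuous)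

lemma test_function_grad_eq_0: "z \<notin> closure {z. \<phi> z \<noteq> 0} \<Longrightarrow> grad \<phi> z = 0"
proof -
  assume "z \<notin> closure {z. \<phi> z \<noteq> 0}"
  then have "z \<in> - closure {z. \<phi> z \<noteq> 0}" by simp
  then have "(\<phi> has_derivative (\<lambda>w. 0 \<bullet> w)) (at z)"
    by (rule has_derivative_transform_within_open[where f = "\<lambda>_. 0" and s = "- closure {z. \<phi> z \<noteq> 0}", rotated 2])
      (use closure_subset[of "{z. \<phi> z \<noteq> 0}"] in auto)
  then show ?thesis by (rule grad_eqI)
qed

text \<open>Allows the partial derivatives of a test function to be inserted as test functions into
  a weak gradient identity. The loss of one order of smoothness is harmless because all orders are
  present, and supports can only shrink.\<close>

lemma test_function_partial:
  shows "test_function \<Omega> (\<lambda>z. Re (grad \<phi> z))" "test_function \<Omega> (\<lambda>z. Im (grad \<phi> z))"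
proof -
  have C: "C_k k (\<lambda>z. Re (grad \<phi> z))" "C_k k (\<lambda>z. Im (grad \<phi> z))" for k
  proof -
    have "C_k (Suc k) \<phi>"
      using test unfolding test_function_def by (elim conjE) (rule spec)
    then show "C_k k (\<lambda>z. Re (grad \<phi> z))" "C_k k (\<lambda>z. Im (grad \<phi> z))"
      by simp_all
  qed
  have K: "compact (closure {z. \<phi> z \<noteq> 0})" "closure {z. \<phi> z \<noteq> 0} \<subseteq> \<Omega>"
    using test unfolding test_function_def by blast+
  have supp: "z \<in> closure {z. \<phi> z \<noteq> 0}" if "grad \<phi> z \<noteq> 0" for z
    using test_function_grad_eq_0 that by blast
  have "{z. Re (grad \<phi> z) \<noteq> 0} \<subseteq> closure {z. \<phi> z \<noteq> 0}"
    "{z. Im (grad \<phi> z) \<noteq> 0} \<subseteq> closure {z. \<phi> z \<noteq> 0}"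
    by (rule subsetI, rule supp, fastforce)+
  then have "closure {z. Re (grad \<phi> z) \<noteq> 0} \<subseteq> closure {z. \<phi> z \<noteq> 0}"
    "closure {z. Im (grad \<phi> z) \<noteq> 0} \<subseteq> closure {z. \<phi> z \<noteq> 0}"
    by (simp_all add: closure_minimal)
  moreover from this have "compact (closure {z. Re (grad \<phi> z) \<noteq> 0})"
    "compact (closure {z. Im (grad \<phi> z) \<noteq> 0})"
    using K(1) bounded_subset unfolding compact_eq_bounded_closed by blast+
  ultimately show "test_function \<Omega> (\<lambda>z. Re (grad \<phi> z))" "test_function \<Omega> (\<lambda>z. Im (grad \<phi> z))"
    using C K(2) unfolding test_function_def by (intro conjI allI; (rule C | blast))+
qed

lemma test_function_bounded: "\<exists>B. \<forall>z. \<bar>\<phi> z\<bar> \<le> B"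
proof -
  have "compact (closure {z. \<phi> z \<noteq> 0})"
    using test unfolding test_function_def by blast
  then have "bounded (\<phi> ` closure {z. \<phi> z \<noteq> 0})"
    by (intro compact_imp_bounded compact_continuous_image
        continuous_on_subset[OF test_function_continuous]) auto
  then obtain B where B: "\<And>z. z \<in> closure {z. \<phi> z \<noteq> 0} \<Longrightarrow> \<bar>\<phi> z\<bar> \<le> B"
    unfolding bounded_iff by auto
  have "\<bar>\<phi> z\<bar> \<le> max B 0" for z
    by (cases "\<phi> z = 0") (use B[of z] closure_subset[of "{z. \<phi> z \<noteq> 0}"] in auto)
  then show ?thesis by blast
qed

end

lemma test_function_grad_continuous:
  assumes "test_function \<Omega> \<phi>"
  shows "continuous_on UNIV (grad \<phi>)"
proof -
  have "continuous_on UNIV (\<lambda>z. Complex (Re (grad \<phi> z)) (Im (grad \<phi> z)))"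
    by (intro continuous_intros test_function_continuous[of \<Omega>] test_function_partial assms)
  then show ?thesis by simp
qed

lemma test_function_grad_bounded:
  assumes "test_function \<Omega> \<phi>"
  shows "\<exists>B. \<forall>z. cmod (grad \<phi> z) \<le> B"
proof -
  obtain B1 B2 where "\<And>z. \<bar>Re (grad \<phi> z)\<bar> \<le> B1" "\<And>z. \<bar>Im (grad \<phi> z)\<bar> \<le> B2"
    using test_function_bounded[OF test_function_partial(1)[OF assms]]
      test_function_bounded[OF test_function_partial(2)[OF assms]] by blast
  then have "cmod (grad \<phi> z) \<le> B1 + B2" for z
    using cmod_le[of "grad \<phi> z"] by (meson add_mono order_trans)
  then show ?thesis by blast
qed

text \<open>Bridges the definitions, which integrate over \<open>lebesgue_on \<Omega>\<close>, and
  Fubini's theorem, which is applied to \<open>lborel\<close>: the integrand is extended by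
  0.\<close>

lemma integral_lebesgue_on_eq_lborel:
  fixes h :: "complex \<Rightarrow> 'b::euclidean_space"
  assumes "open \<Omega>" "(\<lambda>z. indicator \<Omega> z *\<^sub>R h z) \<in> borel_measurable borel"
  shows "integral\<^sup>L (lebesgue_on \<Omega>) h = integral\<^sup>L lborel (\<lambda>z. indicator \<Omega> z *\<^sub>R h z)"
  using assms by (simp add: integral_restrict_space integral_completion borel_open sets_completionI_sets)

lemma borel_measurable_lebesgue_on_indicator:
  fixes h :: "complex \<Rightarrow> 'b::euclidean_space"
  assumes "open \<Omega>" "(\<lambda>z. indicator \<Omega> z *\<^sub>R h z) \<in> borel_measurable borel"
  shows "h \<in> borel_measurable (lebesgue_on \<Omega>)"
proof -
  have "(\<lambda>z. indicator \<Omega> z *\<^sub>R h z) \<in> borel_measurable lebesgue"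
    using assms(2) by (intro measurable_completion) simp
  then show ?thesis
    using assms(1) by (subst borel_measurable_restrict_space_iff) (auto simp: borel_open sets_completionI_sets)
qed

lemma integrable_lborel_bounded:
  fixes h :: "complex \<Rightarrow> 'b::euclidean_space"
  assumes "open \<Omega>" "bounded \<Omega>" "(\<lambda>z. indicator \<Omega> z *\<^sub>R h z) \<in> borel_measurable borel"
    and "\<And>z. z \<in> \<Omega> \<Longrightarrow> norm (h z) \<le> B"
  shows "integrable lborel (\<lambda>z. indicator \<Omega> z *\<^sub>R h z)"
proof -
  \<comment> \<open>The indicator is doubled to fit the rule for bounded functions on a set of
    finite measure; the next step collapses it again.\<close>
  have "integrable lborel (\<lambda>z. indicator \<Omega> z *\<^sub>R (indicator \<Omega> z *\<^sub>R h z))"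
    using assms emeasure_bounded_finite[OF assms(2)]
    by (intro integrableI_bounded_set_indicator[where B = B]) (auto simp: borel_open)
  then show ?thesis
    by (rule Bochner_Integration.integrable_cong[THEN iffD1, rotated 2]) (auto simp: indicator_def)
qed

text \<open>Apply the mean value theorem in x to the difference over y and y + s, then in y to the
  resulting difference of \<open>a\<close>.\<close>

lemma second_difference_mean_value:
  fixes \<phi> :: "real \<Rightarrow> real \<Rightarrow> real"
  assumes 1: "\<And>x y. ((\<lambda>x. \<phi> x y) has_real_derivative a x y) (at x)"
    and 2: "\<And>x y. ((\<lambda>y. a x y) has_real_derivative b x y) (at y)"
    and s: "s > 0"
  shows "\<exists>\<xi> \<eta>. x < \<xi> \<and> \<xi> < x + s \<and> y < \<eta> \<and> \<eta> < y + s \<and>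
    \<phi> (x + s) (y + s) - \<phi> (x + s) y - \<phi> x (y + s) + \<phi> x y = s\<^sup>2 * b \<xi> \<eta>"
proof -
  have "((\<lambda>x. \<phi> x (y + s) - \<phi> x y) has_real_derivative (a x (y + s) - a x y)) (at x)" for x
    by (intro DERIV_diff 1)
  then obtain \<xi> where \<xi>: "x < \<xi>" "\<xi> < x + s"
    "(\<phi> (x + s) (y + s) - \<phi> (x + s) y) - (\<phi> x (y + s) - \<phi> x y) = (x + s - x) * (a \<xi> (y + s) - a \<xi> y)"
    using MVT2[of x "x + s" "\<lambda>x. \<phi> x (y + s) - \<phi> x y" "\<lambda>x. a x (y + s) - a x y"] s by auto
  obtain \<eta> where \<eta>: "y < \<eta>" "\<eta> < y + s" "a \<xi> (y + s) - a \<xi> y = (y + s - y) * b \<xi> \<eta>"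
    using MVT2[of y "y + s" "a \<xi>" "b \<xi>"] s 2 by auto
  show ?thesis
    using \<xi> \<eta> by (intro exI[of _ \<xi>] exI[of _ \<eta>]) (auto simp: power2_eq_square)
qed

text \<open>The second difference over a small square does not depend on the order of the two
  differences, so each mixed derivative takes a common value somewhere in the square; continuity
  brings both points back to \<open>z\<close>.\<close>

lemma mixed_partials_eq:
  fixes \<phi> :: "complex \<Rightarrow> real"
  assumes \<phi>: "\<And>z. (\<phi> has_derivative (\<lambda>w. g z \<bullet> w)) (at z)"
    and a: "\<And>z. ((\<lambda>z. Re (g z)) has_derivative (\<lambda>w. ga z \<bullet> w)) (at z)"
    and b: "\<And>z. ((\<lambda>z. Im (g z)) has_derivative (\<lambda>w. gb z \<bullet> w)) (at z)"
    and cont: "continuous_on UNIV ga" "continuous_on UNIV gb"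
  shows "Im (ga z) = Re (gb z)"
proof (rule ccontr)
  assume "Im (ga z) \<noteq> Re (gb z)"
  \<comment> \<open>Half the supposed gap: two deviations below \<open>e\<close> cannot bridge
    it.\<close>
  define e where "e = \<bar>Im (ga z) - Re (gb z)\<bar> / 2"
  have "e > 0"
    using \<open>Im (ga z) \<noteq> Re (gb z)\<close> by (simp add: e_def)
  have "isCont ga z" "isCont gb z"
    using cont by (simp_all add: continuous_on_eq_continuous_at)
  then have "((\<lambda>w. Im (ga w)) \<longlongrightarrow> Im (ga z)) (nhds z)" "((\<lambda>w. Re (gb w)) \<longlongrightarrow> Re (gb z)) (nhds z)"
    by (simp_all add: continuous_at tendsto_Im tendsto_Re tendsto_at_iff_tendsto_nhds)
  from this[THEN tendstoD, OF \<open>e > 0\<close>] obtain d1 d2 where d: "d1 > 0" "d2 > 0"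
    and d1: "\<And>w. dist w z < d1 \<Longrightarrow> dist (Im (ga w)) (Im (ga z)) < e"
    and d2: "\<And>w. dist w z < d2 \<Longrightarrow> dist (Re (gb w)) (Re (gb z)) < e"
    unfolding eventually_nhds_metric by blast
  \<comment> \<open>A point of the square of side s is within 2 s of its corner \<open>z\<close>, by
    the sum of the coordinate distances.\<close>
  define s where "s = min d1 d2 / 2"
  have s: "s > 0" "2 * s \<le> d1" "2 * s \<le> d2"
    using d by (auto simp: s_def)
  define x y where "x = Re z" and "y = Im z"
  have near: "dist (Complex \<xi> \<eta>) z < 2 * s"
    if "x < \<xi>" "\<xi> < x + s" "y < \<eta>" "\<eta> < y + s" for \<xi> \<eta>
  proof -
    have "dist (Complex \<xi> \<eta>) z \<le> \<bar>\<xi> - x\<bar> + \<bar>\<eta> - y\<bar>"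
      using cmod_le[of "Complex \<xi> \<eta> - z"] by (simp add: dist_norm x_def y_def)
    then show ?thesis using that by linarith
  qed
  let ?D = "\<phi> (Complex (x + s) (y + s)) - \<phi> (Complex (x + s) y) - \<phi> (Complex x (y + s)) + \<phi> (Complex x y)"
  obtain \<xi> \<eta> where 1: "x < \<xi>" "\<xi> < x + s" "y < \<eta>" "\<eta> < y + s" "?D = s\<^sup>2 * Im (ga (Complex \<xi> \<eta>))"
    using second_difference_mean_value[OF has_derivative_horizontal_line[OF \<phi>]
        has_derivative_vertical_line[OF a] s(1)] by blast
  obtain \<eta>' \<xi>' where 2: "y < \<eta>'" "\<eta>' < y + s" "x < \<xi>'" "\<xi>' < x + s"
    "\<phi> (Complex (x + s) (y + s)) - \<phi> (Complex x (y + s)) - \<phi> (Complex (x + s) y) + \<phi> (Complex x y)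
      = s\<^sup>2 * Re (gb (Complex \<xi>' \<eta>'))"
    \<comment> \<open>The same lemma with the roles of x and y exchanged.\<close>
    using second_difference_mean_value[of "\<lambda>y x. \<phi> (Complex x y)" "\<lambda>y x. Im (g (Complex x y))"
      "\<lambda>y x. Re (gb (Complex x y))", OF has_derivative_vertical_line[OF \<phi>]
        has_derivative_horizontal_line[OF b] s(1)] by blast
  have "s\<^sup>2 * Im (ga (Complex \<xi> \<eta>)) = s\<^sup>2 * Re (gb (Complex \<xi>' \<eta>'))"
    using 1(5) 2(5) by linarith
  then have "Im (ga (Complex \<xi> \<eta>)) = Re (gb (Complex \<xi>' \<eta>'))"
    using s(1) by simp
  moreover have "dist (Im (ga (Complex \<xi> \<eta>))) (Im (ga z)) < e"
    using d1 near[OF 1(1-4)] s(2) by force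
  moreover have "dist (Re (gb (Complex \<xi>' \<eta>'))) (Re (gb z)) < e"
    using d2 near[OF 2(3,4,1,2)] s(3) by force
  ultimately have "\<bar>Im (ga z) - Re (gb z)\<bar> < 2 * e"
    unfolding dist_real_def by linarith
  then show False
    by (simp add: e_def)
qed

lemma test_function_mixed_partials:
  assumes "test_function \<Omega> \<phi>"
  shows "Im (grad (\<lambda>z. Re (grad \<phi> z)) z) = Re (grad (\<lambda>z. Im (grad \<phi> z)) z)"
  by (rule mixed_partials_eq[OF test_function_has_derivative[OF assms]
      test_function_has_derivative[OF test_function_partial(1)[OF assms]]
      test_function_has_derivative[OF test_function_partial(2)[OF assms]]
      test_function_grad_continuous[OF test_function_partial(1)[OF assms]]
      test_function_grad_continuous[OF test_function_partial(2)[OF assms]]])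

section \<open>From piecewise gradients to weak solutions\<close>

lemma borel_measurable_indicator_times:
  fixes h :: "complex \<Rightarrow> 'b::euclidean_space" and k :: "complex \<Rightarrow> real"
  assumes "(\<lambda>z. indicator \<Omega> z *\<^sub>R h z) \<in> borel_measurable borel"
    and "(\<lambda>z. indicator \<Omega> z *\<^sub>R k z) \<in> borel_measurable borel"
  shows "(\<lambda>z. indicator \<Omega> z *\<^sub>R (k z *\<^sub>R h z)) \<in> borel_measurable borel"
proof -
  have "(\<lambda>z. (indicator \<Omega> z *\<^sub>R k z) *\<^sub>R (indicator \<Omega> z *\<^sub>R h z)) \<in> borel_measurable borel"
    by (rule borel_measurable_scaleR[OF assms(2,1)])
  also have "(\<lambda>z. (indicator \<Omega> z *\<^sub>R k z) *\<^sub>R (indicator \<Omega> z *\<^sub>R h z)) = (\<lambda>z. indicator \<Omega> z *\<^sub>R (k z *\<^sub>R h z))"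
    by (auto simp: indicator_def)
  finally show ?thesis .
qed

text \<open>A line meets the exceptional set in finitely many points, so the fundamental theorem of
  calculus applies to the product with a test function along every horizontal and vertical line.\<close>

lemma weak_gradient_piecewise:
  assumes \<Omega>: "open \<Omega>" "bounded \<Omega>"
    and cont: "continuous_on \<Omega> u" and ub: "\<And>z. z \<in> \<Omega> \<Longrightarrow> \<bar>u z\<bar> \<le> B"
    and Gm: "(\<lambda>z. indicator \<Omega> z *\<^sub>R G z) \<in> borel_measurable borel"
    and Gb: "\<And>z. z \<in> \<Omega> \<Longrightarrow> cmod (G z) \<le> B"
    and der: "\<And>z. z \<in> \<Omega> - C \<Longrightarrow> (u has_derivative (\<lambda>w. G z \<bullet> w)) (at z)"
    and finx: "\<And>y. finite {x. Complex x y \<in> C}" and finy: "\<And>x. finite {y. Complex x y \<in> C}"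
  shows "weak_gradient \<Omega> u G"
  unfolding weak_gradient_def
proof (intro allI impI)
  fix \<phi> assume test: "test_function \<Omega> \<phi>"
  let ?K = "closure {z. \<phi> z \<noteq> 0}"
  have K: "compact ?K" "?K \<subseteq> \<Omega>"
    using test unfolding test_function_def by blast+
  have \<phi>0: "\<phi> z = 0" if "z \<notin> ?K" for z
    using that closure_subset[of "{z. \<phi> z \<noteq> 0}"] by auto
  have g0: "grad \<phi> z = 0" if "z \<notin> ?K" for z
    by (rule test_function_grad_eq_0[OF test that])
  obtain B\<phi> where B\<phi>: "\<And>z. \<bar>\<phi> z\<bar> \<le> B\<phi>"
    using test_function_bounded[OF test] by blast
  obtain Bg where Bg: "\<And>z. cmod (grad \<phi> z) \<le> Bg"
    using test_function_grad_bounded[OF test] by blast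
  have um: "(\<lambda>z. indicator \<Omega> z *\<^sub>R u z) \<in> borel_measurable borel"
    by (rule borel_measurable_continuous_on_indicator) (use \<Omega> cont in \<open>auto simp: borel_open\<close>)
  have \<phi>m: "(\<lambda>z. indicator \<Omega> z *\<^sub>R \<phi> z) \<in> borel_measurable borel"
    by (rule borel_measurable_continuous_on_indicator)
      (use \<Omega> continuous_on_subset[OF test_function_continuous[OF test]] in \<open>auto simp: borel_open\<close>)
  have gm: "(\<lambda>z. indicator \<Omega> z *\<^sub>R grad \<phi> z) \<in> borel_measurable borel"
    by (rule borel_measurable_continuous_on_indicator)
      (use \<Omega> continuous_on_subset[OF test_function_grad_continuous[OF test]] in \<open>auto simp: borel_open\<close>)
  note m1 = borel_measurable_indicator_times[OF gm um]
  note m2 = borel_measurable_indicator_times[OF Gm \<phi>m]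
  have i1: "integrable lborel (\<lambda>z. indicator \<Omega> z *\<^sub>R (u z *\<^sub>R grad \<phi> z))"
    by (rule integrable_lborel_bounded[OF \<Omega> m1, where B = "B * Bg"])
      (use Bg ub in \<open>auto intro!: mult_mono intro: order_trans[OF abs_ge_zero]\<close>)
  have i2: "integrable lborel (\<lambda>z. indicator \<Omega> z *\<^sub>R (\<phi> z *\<^sub>R G z))"
    by (rule integrable_lborel_bounded[OF \<Omega> m2, where B = "B\<phi> * B"])
      (use B\<phi> Gb in \<open>auto intro!: mult_mono intro: order_trans[OF abs_ge_zero]\<close>)
  \<comment> \<open>\<open>u\<close> is uncontrolled outside \<open>\<Omega>\<close>, so the product
    is cut off there; as the support of \<open>\<phi>\<close> is a compact subset of
    \<open>\<Omega>\<close>, the cut creates no jump.\<close>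
  define F where "F = (\<lambda>z. if z \<in> \<Omega> then u z * \<phi> z else 0)"
  define D where "D = (\<lambda>z. indicator \<Omega> z *\<^sub>R (u z *\<^sub>R grad \<phi> z) + indicator \<Omega> z *\<^sub>R (\<phi> z *\<^sub>R G z))"
  have F0: "F z = 0" "D z = 0" if "z \<notin> ?K" for z
    using \<phi>0[OF that] g0[OF that] by (auto simp: F_def D_def)
  have opn: "open (- ?K)" by (rule open_Compl[OF closed_closure])
  obtain R where R: "\<And>z. z \<in> ?K \<Longrightarrow> cmod z < R"
    using compact_imp_bounded[OF K(1)] bounded_pos_less by blast
  have "integral\<^sup>L lborel D = 0"
  proof (rule integral_gradient_eq_0[where F = F and C = C and R = R])
    show "continuous_on UNIV F"
    proof -
      have "continuous_on \<Omega> F"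
        using continuous_on_mult[OF cont continuous_on_subset[OF test_function_continuous[OF test]]]
        by (subst continuous_on_cong[OF refl, of _ _ "\<lambda>z. u z * \<phi> z"]) (auto simp: F_def)
      moreover have "continuous_on (- ?K) F"
        by (subst continuous_on_cong[OF refl, of _ _ "\<lambda>_. 0"]) (auto simp: F0)
      \<comment> \<open>The open sets \<open>\<Omega>\<close> and the complement of the support
        cover the plane.\<close>
      ultimately have "continuous_on (\<Omega> \<union> - ?K) F"
        using \<Omega>(1) opn by (simp add: continuous_on_open_Un)
      moreover have "\<Omega> \<union> - ?K = UNIV"
        using K(2) by auto
      ultimately show ?thesis by simp
    qed
    show "(F has_derivative (\<lambda>w. D z \<bullet> w)) (at z)" if "z \<notin> C" for z
    proof (cases "z \<in> ?K")
      case True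
      then have z: "z \<in> \<Omega>" using K(2) by blast
      \<comment> \<open>The product rule; the two summands of \<open>D\<close> are the two sides of
        the weak gradient identity.\<close>
      have "((\<lambda>z. u z * \<phi> z) has_derivative (\<lambda>w. D z \<bullet> w)) (at z)"
        by (rule has_derivative_eq_rhs, rule has_derivative_mult[OF der test_function_has_derivative[OF test]])
          (use that z in \<open>auto simp: D_def inner_add_left\<close>)
      then show ?thesis
        by (rule has_derivative_transform_within_open[OF _ \<Omega>(1) z]) (simp add: F_def)
    next
      case False
      then show ?thesis
        by (intro has_derivative_transform_within_open[OF has_derivative_const[of 0] opn, THEN has_derivative_eq_rhs])
          (auto simp: F0)
    qed
    show "integrable lborel D"
      unfolding D_def by (intro Bochner_Integration.integrable_add i1 i2)
  qed (use R F0 finx finy in \<open>auto simp: not_less[symmetric]\<close>)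
  then have "integral\<^sup>L lborel (\<lambda>z. indicator \<Omega> z *\<^sub>R (u z *\<^sub>R grad \<phi> z))
      + integral\<^sup>L lborel (\<lambda>z. indicator \<Omega> z *\<^sub>R (\<phi> z *\<^sub>R G z)) = 0"
    unfolding D_def using i1 i2 by simp
  then show "integral\<^sup>L (lebesgue_on \<Omega>) (\<lambda>z. u z *\<^sub>R grad \<phi> z)
      = - integral\<^sup>L (lebesgue_on \<Omega>) (\<lambda>z. \<phi> z *\<^sub>R G z)"
    unfolding integral_lebesgue_on_eq_lborel[OF \<Omega>(1) m1] integral_lebesgue_on_eq_lborel[OF \<Omega>(1) m2]
    by (simp add: add_eq_0_iff2)
qed

lemma square_integrable_bounded:
  fixes h :: "complex \<Rightarrow> 'b::euclidean_space"
  assumes "open \<Omega>" "bounded \<Omega>" "(\<lambda>z. indicator \<Omega> z *\<^sub>R h z) \<in> borel_measurable borel"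
    and "\<And>z. z \<in> \<Omega> \<Longrightarrow> norm (h z) \<le> B"
  shows "square_integrable \<Omega> h"
proof -
  have hm: "h \<in> borel_measurable (lebesgue_on \<Omega>)"
    by (rule borel_measurable_lebesgue_on_indicator[OF assms(1,3)])
  have fin: "emeasure (lebesgue_on \<Omega>) \<Omega> < \<infinity>"
    using emeasure_bounded_finite[OF assms(2)] assms(1)
    by (simp add: emeasure_restrict_space borel_open sets_completionI_sets)
  have "integrable (lebesgue_on \<Omega>) (\<lambda>z. indicator \<Omega> z *\<^sub>R (norm (h z))\<^sup>2)"
    using assms hm fin
    by (intro integrableI_bounded_set_indicator[where B = "B\<^sup>2"])
      (auto simp: borel_open sets_restrict_space_iff power_mono intro!: AE_I2 sets_completionI_sets)
  then have "integrable (lebesgue_on \<Omega>) (\<lambda>z. (norm (h z))\<^sup>2)"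
    by (rule Bochner_Integration.integrable_cong[THEN iffD1, rotated 2]) (auto simp: indicator_def)
  then show ?thesis
    using hm by (simp add: square_integrable_def)
qed

text \<open>\<open>\<sigma>\<nabla>V\<close> is the gradient of the continuous function \<open>U\<close> turned by a right angle, so its
  weak divergence is a difference of mixed second derivatives of the test function.\<close>

lemma conductivity_solution_conjugate:
  assumes \<Omega>: "open \<Omega>" "bounded \<Omega>"
    and V: "continuous_on \<Omega> V" "\<And>z. z \<in> \<Omega> \<Longrightarrow> \<bar>V z\<bar> \<le> B"
    and U: "continuous_on \<Omega> U" "\<And>z. z \<in> \<Omega> \<Longrightarrow> \<bar>U z\<bar> \<le> B"
    and Gm: "(\<lambda>z. indicator \<Omega> z *\<^sub>R G z) \<in> borel_measurable borel"
    and Gb: "\<And>z. z \<in> \<Omega> \<Longrightarrow> cmod (G z) \<le> B"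
    and Hm: "(\<lambda>z. indicator \<Omega> z *\<^sub>R H z) \<in> borel_measurable borel"
    and Hb: "\<And>z. z \<in> \<Omega> \<Longrightarrow> cmod (H z) \<le> B"
    and H: "\<And>z. z \<in> \<Omega> \<Longrightarrow> H z = \<i> * of_real (\<sigma> z) * G z"
    and derV: "\<And>z. z \<in> \<Omega> - C \<Longrightarrow> (V has_derivative (\<lambda>w. G z \<bullet> w)) (at z)"
    and derU: "\<And>z. z \<in> \<Omega> - C \<Longrightarrow> (U has_derivative (\<lambda>w. H z \<bullet> w)) (at z)"
    and fin: "\<And>y. finite {x. Complex x y \<in> C}" "\<And>x. finite {y. Complex x y \<in> C}"
  shows "conductivity_solution \<Omega> \<sigma> V"
proof -
  have wV: "weak_gradient \<Omega> V G"
    by (rule weak_gradient_piecewise[OF \<Omega> V Gm Gb derV fin])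
  have wU: "weak_gradient \<Omega> U H"
    by (rule weak_gradient_piecewise[OF \<Omega> U Hm Hb derU fin])
  have "square_integrable \<Omega> V"
    by (rule square_integrable_bounded[OF \<Omega> borel_measurable_continuous_on_indicator[OF _ V(1)], where B = B])
      (use \<Omega> V(2) in \<open>auto simp: borel_open\<close>)
  moreover have "square_integrable \<Omega> G"
    by (rule square_integrable_bounded[OF \<Omega> Gm Gb])
  moreover have "integral\<^sup>L (lebesgue_on \<Omega>) (\<lambda>z. \<sigma> z * (G z \<bullet> grad \<phi> z)) = 0"
    if test: "test_function \<Omega> \<phi>" for \<phi>
  proof -
    let ?M = "lebesgue_on \<Omega>"
    \<comment> \<open>Needed for both partial derivatives of \<open>\<phi>\<close>, since real and
      imaginary parts commute with the integral only for integrable functions.\<close>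
    have int1: "integrable ?M (\<lambda>z. \<psi> z *\<^sub>R H z)" "integrable ?M (\<lambda>z. U z *\<^sub>R grad \<psi> z)"
      if \<psi>: "test_function \<Omega> \<psi>" for \<psi>
    proof -
      have fin: "emeasure ?M (space ?M) < \<infinity>"
        using emeasure_bounded_finite[OF \<Omega>(2)] \<Omega>(1)
        by (simp add: emeasure_restrict_space borel_open sets_completionI_sets space_restrict_space)
      then interpret finite_measure ?M
        by (intro finite_measureI) simp
      have \<psi>m: "(\<lambda>z. indicator \<Omega> z *\<^sub>R \<psi> z) \<in> borel_measurable borel"
        by (rule borel_measurable_continuous_on_indicator)
          (use \<Omega> continuous_on_subset[OF test_function_continuous[OF \<psi>]] in \<open>auto simp: borel_open\<close>)
      have gm: "(\<lambda>z. indicator \<Omega> z *\<^sub>R grad \<psi> z) \<in> borel_measurable borel"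
        by (rule borel_measurable_continuous_on_indicator)
          (use \<Omega> continuous_on_subset[OF test_function_grad_continuous[OF \<psi>]] in \<open>auto simp: borel_open\<close>)
      have Um: "(\<lambda>z. indicator \<Omega> z *\<^sub>R U z) \<in> borel_measurable borel"
        by (rule borel_measurable_continuous_on_indicator) (use \<Omega> U in \<open>auto simp: borel_open\<close>)
      obtain B1 where B1: "\<And>z. \<bar>\<psi> z\<bar> \<le> B1"
        using test_function_bounded[OF \<psi>] by blast
      obtain B2 where B2: "\<And>z. cmod (grad \<psi> z) \<le> B2"
        using test_function_grad_bounded[OF \<psi>] by blast
      show "integrable ?M (\<lambda>z. \<psi> z *\<^sub>R H z)"
        by (rule integrable_const_bound[where B = "B1 * B"])
          (use B1 Hb borel_measurable_lebesgue_on_indicator[OF \<Omega>(1) borel_measurable_indicator_times[OF Hm \<psi>m]]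
            in \<open>auto intro!: AE_I2 mult_mono intro: order_trans[OF abs_ge_zero] simp: space_restrict_space\<close>)
      show "integrable ?M (\<lambda>z. U z *\<^sub>R grad \<psi> z)"
        by (rule integrable_const_bound[where B = "B * B2"])
          (use B2 U order_trans[OF abs_ge_zero U(2)] borel_measurable_lebesgue_on_indicator[OF \<Omega>(1) borel_measurable_indicator_times[OF gm Um]]
            in \<open>auto intro!: AE_I2 mult_mono intro: order_trans[OF abs_ge_zero] simp: space_restrict_space\<close>)
    qed
    define a b where "a = (\<lambda>z. Re (grad \<phi> z))" and "b = (\<lambda>z. Im (grad \<phi> z))"
    have ta: "test_function \<Omega> a" and tb: "test_function \<Omega> b"
      using test_function_partial[OF test] by (simp_all add: a_def b_def)
    \<comment> \<open>From \<open>H = \<i> * \<sigma> * G\<close> one reads off that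
      \<open>Im H\<close> is \<open>\<sigma> * Re G\<close> and \<open>Re H\<close> is
      \<open>- \<sigma> * Im G\<close>.\<close>
    have "integral\<^sup>L ?M (\<lambda>z. \<sigma> z * (G z \<bullet> grad \<phi> z))
        = integral\<^sup>L ?M (\<lambda>z. Im (a z *\<^sub>R H z) - Re (b z *\<^sub>R H z))"
      by (rule Bochner_Integration.integral_cong)
        (auto simp: H a_def b_def inner_complex_def space_restrict_space algebra_simps)
    also have "\<dots> = Im (integral\<^sup>L ?M (\<lambda>z. a z *\<^sub>R H z)) - Re (integral\<^sup>L ?M (\<lambda>z. b z *\<^sub>R H z))"
      by (subst Bochner_Integration.integral_diff[OF integrable_Im[OF int1(1)[OF ta]] integrable_Re[OF int1(1)[OF tb]]])
        (simp only: integral_Im[OF int1(1)[OF ta]] integral_Re[OF int1(1)[OF tb]])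
    \<comment> \<open>The weak gradient identity of \<open>U\<close>, tested with \<open>a\<close>
      and with \<open>b\<close>; its minus sign exchanges the order of the difference.\<close>
    also have "\<dots> = Re (integral\<^sup>L ?M (\<lambda>z. U z *\<^sub>R grad b z)) - Im (integral\<^sup>L ?M (\<lambda>z. U z *\<^sub>R grad a z))"
      using wU ta tb unfolding weak_gradient_def by simp
    also have "\<dots> = integral\<^sup>L ?M (\<lambda>z. Re (U z *\<^sub>R grad b z)) - integral\<^sup>L ?M (\<lambda>z. Im (U z *\<^sub>R grad a z))"
      by (simp only: integral_Im[OF int1(2)[OF ta]] integral_Re[OF int1(2)[OF tb]])
    also have "\<dots> = 0"
      using test_function_mixed_partials[OF test] by (simp add: a_def b_def)
    finally show ?thesis .
  qed
  ultimately show ?thesis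
    using wV unfolding conductivity_solution_def by blast
qed

section \<open>Inclusions bounded by curves with an analytic continuation of y\<close>

text \<open>Cover \<open>K\<close> by finitely many small closed balls inside \<open>S\<close> and
  join their centres to one base point by paths in \<open>S\<close>.\<close>

lemma compact_connected_superset:
  fixes S :: "'a::euclidean_space set"
  assumes "open S" "connected S" "compact K" "K \<subseteq> S"
  obtains T where "compact T" "connected T" "K \<subseteq> T" "T \<subseteq> S"
proof (cases "K = {}")
  case True
  then show ?thesis using that[of "{}"] by simp
next
  case False
  then obtain a where a: "a \<in> S" using assms(4) by blast
  obtain e where e: "e > 0" "(\<Union>x\<in>K. ball x e) \<subseteq> S"
    using compact_subset_open_imp_ball_epsilon_subset[OF assms(3,1,4)] .
  \<comment> \<open>Radius e/2 leaves room for the closed balls of the same radius, which make up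
    \<open>T\<close>, to stay inside \<open>S\<close>.\<close>
  obtain X where X: "X \<subseteq> K" "finite X" "K \<subseteq> (\<Union>x\<in>X. ball x (e/2))"
  proof (rule compactE_image[OF assms(3), of K "\<lambda>x. ball x (e/2)"])
    show "K \<subseteq> (\<Union>x\<in>K. ball x (e/2))" using e(1) by auto
  qed auto
  have "path_connected S"
    using assms by (simp add: connected_open_path_connected)
  then have "\<exists>g. path g \<and> path_image g \<subseteq> S \<and> pathstart g = a \<and> pathfinish g = x" if "x \<in> X" for x
    using a that X(1) assms(4) unfolding path_connected_def by blast
  then obtain g where g: "\<And>x. x \<in> X \<Longrightarrow> path (g x)" "\<And>x. x \<in> X \<Longrightarrow> path_image (g x) \<subseteq> S"
    "\<And>x. x \<in> X \<Longrightarrow> pathstart (g x) = a" "\<And>x. x \<in> X \<Longrightarrow> pathfinish (g x) = x"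
    by metis
  define T where "T = (\<Union>x\<in>X. path_image (g x) \<union> cball x (e/2))"
  have "compact T"
    unfolding T_def using X(2) g(1) by (intro compact_UN compact_Un compact_path_image) auto
  moreover have "connected T"
    unfolding T_def
  proof (rule connected_Union)
    show "connected s" if s: "s \<in> (\<lambda>x. path_image (g x) \<union> cball x (e/2)) ` X" for s
    proof -
      obtain x where x: "x \<in> X" "s = path_image (g x) \<union> cball x (e/2)"
        using s by blast
      have "x \<in> path_image (g x) \<inter> cball x (e/2)"
        using g(4)[OF x(1)] pathfinish_in_path_image[of "g x"] e(1) by simp
      then show ?thesis
        unfolding x(2) using g(1)[OF x(1)]
        by (intro connected_Un connected_path_image) auto
    qed
    have "a \<in> path_image (g x)" if "x \<in> X" for x
      using g(3)[OF that] pathstart_in_path_image[of "g x"] by simp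
    then show "\<Inter> ((\<lambda>x. path_image (g x) \<union> cball x (e/2)) ` X) \<noteq> {}"
      by blast
  qed
  moreover have "(\<Union>x\<in>X. ball x (e/2)) \<subseteq> T"
    unfolding T_def by (intro UN_mono le_supI2 ball_subset_cball order_refl)
  then have "K \<subseteq> T"
    using X(3) by (rule order_trans[rotated])
  moreover have "T \<subseteq> S"
  proof -
    have "cball x (e/2) \<subseteq> S" if "x \<in> X" for x
    proof -
      have "cball x (e/2) \<subseteq> ball x e" using e(1) by auto
      then show ?thesis using e(2) that X(1) by blast
    qed
    then show ?thesis using g(2) unfolding T_def by blast
  qed
  ultimately show ?thesis by (rule that)
qed

text \<open>A bounded open connected planar set is simply connected when its complement is
  connected. So the complement of \<open>M\<close> is enlarged to a connected closed set
  \<open>Q\<close> that still avoids \<open>K\<close>, and \<open>\<Omega>\<close> is the component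
  of the complement of \<open>Q\<close> that contains \<open>K\<close>: removing one such component
  from the plane leaves a connected set.\<close>

lemma simply_connected_neighbourhood:
  fixes K M :: "complex set"
  assumes K: "compact K" "connected K" "K \<noteq> {}" "connected (- K)"
    and M: "open M" "bounded M" "K \<subseteq> M"
  obtains \<Omega> where "open \<Omega>" "bounded \<Omega>" "simply_connected \<Omega>" "K \<subseteq> \<Omega>" "\<Omega> \<subseteq> M"
proof -
  obtain R where R: "R > 0" "M \<subseteq> ball 0 R"
    using bounded_subset_ballD[OF M(2)] by blast
  have "compact (- M \<inter> cball 0 R)"
    using M(1) by (intro closed_Int_compact) auto
  moreover have "open (- K)"
    using K(1) by (simp add: compact_imp_closed open_Compl)
  ultimately obtain T where T: "compact T" "connected T" "- M \<inter> cball 0 R \<subseteq> T" "T \<subseteq> - K"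
    using compact_connected_superset[of "- K" "- M \<inter> cball 0 R"] K(4) M(3) by auto
  define Q where "Q = T \<union> - ball 0 R"
  \<comment> \<open>A common point of \<open>T\<close> and the exterior of the ball, so that their
    union is connected.\<close>
  have "complex_of_real R \<in> T \<inter> - ball 0 R"
  proof -
    have "complex_of_real R \<notin> M" "cmod (complex_of_real R) \<le> R"
      using R by auto
    then have "complex_of_real R \<in> T" using T(3) by auto
    then show ?thesis using R(1) by simp
  qed
  moreover have "connected (- ball (0::complex) R)"
    by (intro connected_complement_bounded_convex) auto
  ultimately have Q: "connected Q"
    unfolding Q_def using T(2) by (intro connected_Un) auto
  have "closed Q"
    unfolding Q_def by (rule closed_Un[OF compact_imp_closed[OF T(1)] closed_Compl[OF open_ball]])
  have KQ: "K \<subseteq> - Q"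
    using T(4) R(2) M(3) unfolding Q_def by blast
  obtain k where k: "k \<in> K" using K(3) by blast
  define \<Omega> where "\<Omega> = connected_component_set (- Q) k"
  have comp: "\<Omega> \<in> components (- Q)"
    unfolding \<Omega>_def using k KQ by (auto simp: components_def)
  have "open \<Omega>"
    using \<open>closed Q\<close> comp by (meson open_Compl open_components)
  have "\<Omega> \<subseteq> - Q"
    using comp by (rule in_components_subset)
  also have "- Q \<subseteq> M"
    using T(3) R(2) unfolding Q_def by (auto simp: subset_iff)
  finally have "\<Omega> \<subseteq> M" .
  then have "bounded \<Omega>"
    using M(2) bounded_subset by blast
  have "simply_connected \<Omega>"
    using simply_connected_iff_simple[OF \<open>open \<Omega>\<close> \<open>bounded \<Omega>\<close>] component_complement_connected[OF Q comp]
      in_components_connected[OF comp] by simp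
  moreover have "K \<subseteq> \<Omega>"
    unfolding \<Omega>_def using K(2) k KQ by (intro connected_component_maximal)
  ultimately show ?thesis
    using that \<open>open \<Omega>\<close> \<open>bounded \<Omega>\<close> \<open>\<Omega> \<subseteq> M\<close> by blast
qed

text \<open>The set \<open>D\<close> collects the pairs that do not violate injectivity. Its
  interior contains all of \<open>S \<times> S\<close>: on the diagonal because a nonzero derivative
  gives local injectivity, off the diagonal by continuity. Compactness then yields a uniform
  radius.\<close>

lemma inj_on_neighbourhood_of_compact:
  assumes hol: "f holomorphic_on A" "open A" and S: "compact S" "S \<subseteq> A"
    and inj: "inj_on f S" and der: "\<And>z. z \<in> S \<Longrightarrow> deriv f z \<noteq> 0"
  obtains N where "open N" "S \<subseteq> N" "N \<subseteq> A" "inj_on f N"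
proof -
  define D where "D = {p \<in> A \<times> A. fst p = snd p \<or> f (fst p) \<noteq> f (snd p)}"
  have cont: "continuous_on A f"
    by (rule holomorphic_on_imp_continuous_on[OF hol(1)])
  have "p \<in> interior D" if p: "p \<in> S \<times> S" for p
  proof -
    obtain a b where ab: "p = (a, b)" "a \<in> S" "b \<in> S" using p by blast
    show ?thesis
    proof (cases "a = b")
      case True
      obtain r where r: "r > 0" "ball a r \<subseteq> A" "inj_on f (ball a r)"
        using has_complex_derivative_locally_injective[OF hol(1) _ hol(2) der[OF ab(2)]] ab(2) S(2) by blast
      have "ball a r \<times> ball a r \<subseteq> D"
        using r(2,3) unfolding D_def inj_on_def by fastforce
      moreover have "open (ball a r \<times> ball a r)" "p \<in> ball a r \<times> ball a r"
        using r(1) True ab(1) by (auto intro: open_Times)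
      ultimately show ?thesis by (metis interiorI)
    next
      case False
      let ?P = "(A \<times> A) \<inter> (\<lambda>p. f (fst p) - f (snd p)) -` (- {0})"
      have "continuous_on (A \<times> A) (\<lambda>p. f (fst p) - f (snd p))"
        by (intro continuous_on_diff continuous_on_compose2[OF cont continuous_on_fst[OF continuous_on_id]]
            continuous_on_compose2[OF cont continuous_on_snd[OF continuous_on_id]]) auto
      then have "open ?P"
        by (rule continuous_open_preimage) (auto intro: open_Times hol(2))
      moreover have "p \<in> ?P"
        using False ab S(2) inj by (auto simp: inj_on_def)
      moreover have "?P \<subseteq> D"
        by (auto simp: D_def)
      ultimately show ?thesis by (metis interiorI)
    qed
  qed
  then have "S \<times> S \<subseteq> interior D" by blast
  then obtain e where e: "e > 0" "(\<Union>p\<in>S \<times> S. ball p e) \<subseteq> interior D"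
    using compact_subset_open_imp_ball_epsilon_subset[OF compact_Times[OF S(1) S(1)] open_interior] by metis
  \<comment> \<open>Radius e/2, because the distance of two pairs is at most the sum of the
    distances of their components.\<close>
  define N where "N = (\<Union>s\<in>S. ball s (e/2))"
  have near: "(x, y) \<in> D" if xy: "x \<in> N" "y \<in> N" for x y
  proof -
    obtain s t where st: "s \<in> S" "t \<in> S" "dist s x < e/2" "dist t y < e/2"
      using xy unfolding N_def by auto
    have "dist (s, t) (x, y) \<le> dist s x + dist t y"
      unfolding dist_Pair_Pair by (rule sqrt_sum_squares_le_sum) auto
    then have "(x, y) \<in> ball (s, t) e"
      using st by simp
    then show ?thesis
      using e(2) st interior_subset[of D] by blast
  qed
  show ?thesis
  proof
    show "open N" unfolding N_def by auto
    show "S \<subseteq> N" unfolding N_def using e(1) by auto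
    show "N \<subseteq> A" using near unfolding D_def by auto
    show "inj_on f N" using near unfolding D_def inj_on_def by auto
  qed
qed

text \<open>The Cauchy-Riemann equations in gradient form: the second gradient is the first turned
  by a right angle, which is the relation between flux function and potential where the conductivity
  is 1.\<close>

lemma has_derivative_Re_Im_holomorphic:
  assumes "(W has_field_derivative W') (at z)"
  shows "((\<lambda>z. Re (W z)) has_derivative (\<lambda>w. cnj W' \<bullet> w)) (at z)"
    and "((\<lambda>z. Im (W z)) has_derivative (\<lambda>w. (\<i> * cnj W') \<bullet> w)) (at z)"
proof -
  have W: "(W has_derivative (\<lambda>w. W' * w)) (at z)"
    using assms by (simp add: has_field_derivative_def)
  have eq: "(\<lambda>w. cnj W' \<bullet> w) = (\<lambda>w. Re (W' * w))" "(\<lambda>w. (\<i> * cnj W') \<bullet> w) = (\<lambda>w. Im (W' * w))"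
    by (auto simp: inner_complex_def fun_eq_iff)
  show "((\<lambda>z. Re (W z)) has_derivative (\<lambda>w. cnj W' \<bullet> w)) (at z)"
    "((\<lambda>z. Im (W z)) has_derivative (\<lambda>w. (\<i> * cnj W') \<bullet> w)) (at z)"
    unfolding eq by (rule has_derivative_Re[OF W], rule has_derivative_Im[OF W])
qed

lemma continuous_on_glued_across_frontier:
  fixes f g :: "'a::topological_space \<Rightarrow> 'b::topological_space"
  assumes "open E" "continuous_on (closure E) f" "continuous_on (\<Omega> - E) g"
    and "\<And>z. z \<in> frontier E \<Longrightarrow> f z = g z" "closure E \<subseteq> \<Omega>"
  shows "continuous_on \<Omega> (\<lambda>z. if z \<in> E then f z else g z)"
proof -
  have \<Omega>: "\<Omega> = closure E \<union> (\<Omega> - E)"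
    using assms(5) closure_subset by blast
  have c1: "closedin (top_of_set \<Omega>) (closure E)"
    by (rule closed_subset[OF assms(5) closed_closure])
  have "\<Omega> - E = \<Omega> \<inter> - E" by blast
  then have c2: "closedin (top_of_set \<Omega>) (\<Omega> - E)"
    using assms(1) by (metis closedin_closed closed_Compl)
  have fr: "closure E - E = frontier E"
    using assms(1) by (simp add: frontier_def interior_open)
  have "continuous_on (closure E \<union> (\<Omega> - E)) (\<lambda>z. if z \<in> E then f z else g z)"
    by (rule continuous_on_cases_local)
      (use assms(2-4) c1 c2 \<Omega>[symmetric] fr in auto)
  then show ?thesis
    using \<Omega> by simp
qed

text \<open>The holomorphic extension \<open>h\<close> of the height function is all that is used of
  the shape of the curve, besides the finiteness of its sections; the Jordan curve theorem supplies
  the topology of the inside.\<close>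

lemma E_Omega_inclusion_inside:
  fixes p :: "real \<Rightarrow> complex" and s :: real
  assumes p: "simple_path p" "pathfinish p = pathstart p"
    and N: "open N" "path_image p \<subseteq> N" and h: "h holomorphic_on N"
    and hC: "\<And>z. z \<in> path_image p \<Longrightarrow> h z = of_real (Im z)"
    and fin: "\<And>y. finite {x. Complex x y \<in> path_image p}" "\<And>x. finite {y. Complex x y \<in> path_image p}"
  shows "E_Omega_inclusion s (inside (path_image p))"
proof -
  define C where "C = path_image p"
  define E where "E = inside C"
  have J: "E \<noteq> {}" "open E" "connected E" "connected (outside C)" "bounded E" "frontier E = C"
    "E \<inter> outside C = {}" "E \<union> outside C = - C"
    using Jordan_inside_outside[OF p] unfolding E_def C_def by simp_all
  have sc: "simply_connected E"
    unfolding E_def C_def by (rule simply_connected_inside_simple_path[OF p(1)])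
  have C: "compact C" "C \<noteq> {}"
    using p(1) by (auto simp: C_def simple_path_imp_path compact_path_image)
  define K where "K = closure E"
  have KE: "K = E \<union> C" "E \<inter> C = {}"
    using J(2,6) closure_subset[of E] by (auto simp: K_def frontier_def interior_open)
  have "- K = outside C"
    using J(7,8) KE by blast
  then have K: "compact K" "connected K" "K \<noteq> {}" "connected (- K)"
    using J by (auto simp: K_def compact_eq_bounded_closed connected_imp_connected_closure)
  \<comment> \<open>Two collars of the curve are needed: a compact one inside \<open>N\<close>, on
    which \<open>W\<close> and its derivative are bounded, and an open one inside it, to build the
    body.\<close>
  obtain e where e: "e > 0" "{x. infdist x C \<le> e} \<subseteq> N"
    using compact_in_open_separated[OF C(2,1) N(1)] N(2) C_def by blast
  define K1 where "K1 = {x. infdist x C \<le> e}"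
  have K1: "compact K1" "K1 \<subseteq> N"
    using e C compact_infdist_le by (auto simp: K1_def)
  define N1 where "N1 = {x. infdist x C < e}"
  have N1: "open N1" "C \<subseteq> N1" "N1 \<subseteq> K1"
    using e(1) by (auto simp: N1_def K1_def intro!: open_Collect_less continuous_intros)
  have "bounded (E \<union> N1)"
    using J(5) K1(1) N1(3) by (meson bounded_Un bounded_subset compact_imp_bounded)
  \<comment> \<open>Outside the closed inclusion the body stays in the collar, so \<open>W\<close>
    is defined there.\<close>
  then obtain \<Omega> where \<Omega>: "open \<Omega>" "bounded \<Omega>" "simply_connected \<Omega>" "K \<subseteq> \<Omega>" "\<Omega> \<subseteq> E \<union> N1"
    using simply_connected_neighbourhood[OF K, of "E \<union> N1"] J(2) N1(1,2) KE by blast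
  have ext: "z \<in> K1" "z \<in> N" if "z \<in> \<Omega>" "z \<notin> E" for z
    using that \<Omega>(5) N1(3) K1(2) by blast+
  define W where "W = (\<lambda>z. z + \<i> * of_real (s - 1) * h z)"
  have W: "W holomorphic_on N"
    unfolding W_def by (intro holomorphic_intros h)
  have W': "deriv W holomorphic_on N"
    by (rule holomorphic_deriv[OF W N(1)])
  have WC: "Re (W z) = Re z" "Im (W z) = s * Im z" if "z \<in> C" for z
    using hC that by (auto simp: W_def C_def algebra_simps)
  have Wder: "(W has_field_derivative deriv W z) (at z)" if "z \<in> N" for z
    using W N(1) that by (rule holomorphic_derivI)
  obtain B1 where B1: "\<And>z. z \<in> K1 \<Longrightarrow> cmod (W z) \<le> B1"
    using compact_imp_bounded[OF compact_continuous_image[OF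
          continuous_on_subset[OF holomorphic_on_imp_continuous_on[OF W] K1(2)] K1(1)]]
    unfolding bounded_iff by blast
  obtain B2 where B2: "\<And>z. z \<in> K1 \<Longrightarrow> cmod (deriv W z) \<le> B2"
    using compact_imp_bounded[OF compact_continuous_image[OF
          continuous_on_subset[OF holomorphic_on_imp_continuous_on[OF W'] K1(2)] K1(1)]]
    unfolding bounded_iff by blast
  obtain B3 where B3: "\<And>z. z \<in> E \<Longrightarrow> cmod z \<le> B3"
    using J(5) unfolding bounded_iff by blast
  \<comment> \<open>One bound for everything: \<open>B1\<close> serves \<open>W\<close>,
    \<open>B2\<close> its derivative, 1 and the modulus of \<open>s\<close> the constant gradients
    inside, and the \<open>B3\<close> terms the potentials inside.\<close>
  define B where "B = max (max B1 (B2 + \<bar>s\<bar> + 1)) (max B3 (\<bar>s\<bar> * B3))"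
  define \<sigma> where "\<sigma> = (\<lambda>z. if z \<in> E then s else 1)"
  define V where "V = (\<lambda>z. if z \<in> E then Re z else Re (W z))"
  define U where "U = (\<lambda>z. if z \<in> E then s * Im z else Im (W z))"
  \<comment> \<open>The value 0 on the curve itself is arbitrary, as the weak gradient ignores
    \<open>C\<close>; it makes \<open>G\<close> a sum of continuous functions cut off to the open
    sets \<open>E\<close> and \<open>\<Omega> - K\<close>, hence Borel.\<close>
  define G where "G = (\<lambda>z. if z \<in> E then 1 else if z \<in> \<Omega> - K then cnj (deriv W z) else 0)"
  define H where "H = (\<lambda>z. \<i> * of_real (\<sigma> z) * G z)"
  have Vc: "continuous_on \<Omega> V" "continuous_on \<Omega> U"
  proof -
    have 1: "continuous_on (\<Omega> - E) W"
      by (rule continuous_on_subset[OF holomorphic_on_imp_continuous_on[OF W]]) (use ext in blast)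
    show "continuous_on \<Omega> V" unfolding V_def
      by (rule continuous_on_glued_across_frontier[OF J(2)])
        (use 1 WC J(6) \<Omega>(4) K_def in \<open>auto intro!: continuous_intros\<close>)
    show "continuous_on \<Omega> U" unfolding U_def
      by (rule continuous_on_glued_across_frontier[OF J(2)])
        (use 1 WC J(6) \<Omega>(4) K_def in \<open>auto intro!: continuous_intros\<close>)
  qed
  have B0: "0 \<le> B2" if "z \<in> K1" for z
    using B2[OF that] norm_ge_zero order_trans by blast
  have C1: "0 \<le> B2"
    using B0 N1(2,3) C(2) by blast
  have Vb: "\<bar>V z\<bar> \<le> B" "\<bar>U z\<bar> \<le> B" if z: "z \<in> \<Omega>" for z
  proof -
    show "\<bar>V z\<bar> \<le> B"
    proof (cases "z \<in> E")
      case True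
      then show ?thesis
        using abs_Re_le_cmod[of z] B3[of z] by (auto simp: V_def B_def)
    next
      case False
      then show ?thesis
        using abs_Re_le_cmod[of "W z"] B1[OF ext(1)[OF z]] by (auto simp: V_def B_def)
    qed
    show "\<bar>U z\<bar> \<le> B"
    proof (cases "z \<in> E")
      case True
      have "\<bar>s * Im z\<bar> \<le> \<bar>s\<bar> * B3"
        unfolding abs_mult using abs_Im_le_cmod[of z] B3[OF True] by (intro mult_left_mono) auto
      then show ?thesis
        using True by (auto simp: U_def B_def)
    next
      case False
      then show ?thesis
        using abs_Im_le_cmod[of "W z"] B1[OF ext(1)[OF z]] by (auto simp: U_def B_def)
    qed
  qed
  have Gb: "cmod (G z) \<le> B" "cmod (H z) \<le> B" if z: "z \<in> \<Omega>" for z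
  proof -
    have "cmod (G z) \<le> B \<and> cmod (H z) \<le> B"
    proof (cases "z \<in> E")
      case True
      then show ?thesis
        using C1 by (auto simp: H_def G_def B_def \<sigma>_def norm_mult)
    next
      case False
      then show ?thesis
        using B2[OF ext(1)[OF z]] C1 by (auto simp: H_def G_def B_def \<sigma>_def norm_mult)
    qed
    then show "cmod (G z) \<le> B" "cmod (H z) \<le> B" by simp_all
  qed
  have EO: "E \<subseteq> \<Omega>" using KE \<Omega>(4) by blast
  have opn: "open (\<Omega> - K)" using \<Omega>(1) K(1) by (simp add: open_Diff compact_imp_closed)
  have cW': "continuous_on (\<Omega> - K) (\<lambda>z. cnj (deriv W z))"
    by (intro continuous_on_cnj continuous_on_subset[OF holomorphic_on_imp_continuous_on[OF W']])
      (use ext KE in blast)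
  have mW': "(\<lambda>z. indicator (\<Omega> - K) z *\<^sub>R cnj (deriv W z)) \<in> borel_measurable borel"
    by (rule borel_measurable_continuous_on_indicator[OF borel_open[OF opn] cW'])
  have mE: "(\<lambda>z. indicator E z *\<^sub>R (c::complex)) \<in> borel_measurable borel" for c
    by (rule borel_measurable_continuous_on_indicator[OF borel_open[OF J(2)] continuous_on_const])
  have Gm: "(\<lambda>z. indicator \<Omega> z *\<^sub>R G z) \<in> borel_measurable borel"
  proof -
    have "(\<lambda>z. indicator \<Omega> z *\<^sub>R G z)
        = (\<lambda>z. indicator E z *\<^sub>R 1 + indicator (\<Omega> - K) z *\<^sub>R cnj (deriv W z))"
      using EO KE by (auto simp: G_def indicator_def fun_eq_iff)
    then show ?thesis
      using borel_measurable_add[OF mE[of 1] mW'] by simp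
  qed
  have Hm: "(\<lambda>z. indicator \<Omega> z *\<^sub>R H z) \<in> borel_measurable borel"
  proof -
    have "(\<lambda>z. indicator \<Omega> z *\<^sub>R H z)
        = (\<lambda>z. indicator E z *\<^sub>R (\<i> * of_real s) + \<i> * (indicator (\<Omega> - K) z *\<^sub>R cnj (deriv W z)))"
      using EO KE by (auto simp: H_def G_def \<sigma>_def indicator_def fun_eq_iff)
    then show ?thesis
      using borel_measurable_add[OF mE[of "\<i> * of_real s"] borel_measurable_times[OF borel_measurable_const[of \<i>] mW']]
      by simp
  qed
  have der: "(V has_derivative (\<lambda>w. G z \<bullet> w)) (at z) \<and> (U has_derivative (\<lambda>w. H z \<bullet> w)) (at z)"
    if z: "z \<in> \<Omega> - C" for z
  proof (cases "z \<in> E")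
    case True
    have "(Re has_derivative (\<lambda>w. G z \<bullet> w)) (at z)"
      using True has_derivative_Re_Im_holomorphic(1)[OF DERIV_ident] by (simp add: G_def)
    \<comment> \<open>Inside, the flux function is the imaginary part of the holomorphic function s
      z.\<close>
    moreover have "((\<lambda>z. s * Im z) has_derivative (\<lambda>w. H z \<bullet> w)) (at z)"
      using True has_derivative_Re_Im_holomorphic(2)[OF DERIV_cmult[OF DERIV_ident, of "of_real s"]]
      by (simp add: G_def H_def \<sigma>_def)
    ultimately show ?thesis
      using has_derivative_transform_within_open[OF _ J(2) True, of Re _ UNIV V]
        has_derivative_transform_within_open[OF _ J(2) True, of "\<lambda>z. s * Im z" _ UNIV U]
      by (simp add: V_def U_def)
  next
    case False
    then have zK: "z \<in> \<Omega> - K" using z KE by blast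
    have "((\<lambda>z. Re (W z)) has_derivative (\<lambda>w. G z \<bullet> w)) (at z)"
      using False zK has_derivative_Re_Im_holomorphic(1)[OF Wder[OF ext(2)]] z by (simp add: G_def)
    moreover have "((\<lambda>z. Im (W z)) has_derivative (\<lambda>w. H z \<bullet> w)) (at z)"
      using False zK has_derivative_Re_Im_holomorphic(2)[OF Wder[OF ext(2)]] z by (simp add: G_def H_def \<sigma>_def)
    moreover have "Re (W w) = V w" "Im (W w) = U w" if "w \<in> \<Omega> - K" for w
      using that KE by (auto simp: V_def U_def)
    ultimately show ?thesis
      using has_derivative_transform_within_open[OF _ opn zK, of "\<lambda>z. Re (W z)" _ UNIV V]
        has_derivative_transform_within_open[OF _ opn zK, of "\<lambda>z. Im (W z)" _ UNIV U] by blast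
  qed
  have "conductivity_solution \<Omega> \<sigma> V"
    by (rule conductivity_solution_conjugate[OF \<Omega>(1,2) Vc(1) Vb(1) Vc(2) Vb(2) Gm Gb(1) Hm Gb(2), where C = C])
      (use der fin H_def C_def in blast)+
  then show ?thesis
    unfolding E_Omega_inclusion_def C_def[symmetric] E_def[symmetric]
    using J(1,2) sc \<Omega> K_def by (intro conjI exI[of _ \<Omega>] exI[of _ V]) (auto simp: V_def \<sigma>_def)
qed

section \<open>Generated curves as images of the unit circle\<close>

lemma cayley_denominator: "1 - \<i> * of_real t \<noteq> (0::complex)" "1 + \<i> * of_real t \<noteq> (0::complex)"
  by (auto simp: complex_eq_iff)

definition cayley :: "complex \<Rightarrow> complex" where
  "cayley \<zeta> = \<i> * (1 - \<zeta>) / (1 + \<zeta>)"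

text \<open>The inverse of \<open>cayley\<close> on the real line: the stereographic parametrization
  of the unit circle without -1, the point that stands for t = infinity.\<close>

definition circle_point :: "real \<Rightarrow> complex" where
  "circle_point t = (1 + \<i> * of_real t) / (1 - \<i> * of_real t)"

lemma cayley_circle_point: "cayley (circle_point t) = of_real t"
proof -
  have "1 + circle_point t = 2 / (1 - \<i> * of_real t)" "1 - circle_point t = - 2 * \<i> * of_real t / (1 - \<i> * of_real t)"
    using cayley_denominator[of t] by (auto simp: circle_point_def field_simps)
  then show ?thesis
    using cayley_denominator[of t] by (simp add: cayley_def)
qed

lemma norm_circle_point: "cmod (circle_point t) = 1"
proof -
  have "cmod (1 + \<i> * of_real t) = cmod (1 - \<i> * of_real t)"
    by (simp add: cmod_def)
  then show ?thesis
    using cayley_denominator[of t] by (simp add: circle_point_def norm_divide)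
qed

lemma Re_circle_point: "Re (circle_point t) = (1 - t\<^sup>2) / (1 + t\<^sup>2)"
  unfolding circle_point_def by (simp add: Re_divide power2_eq_square)

lemma circle_point_ne: "circle_point t \<noteq> -1"
  using cayley_denominator[of t] by (auto simp: circle_point_def divide_eq_eq)

text \<open>Ties the symmetry of the circle to the hypothesis comparing f at t and at -t.\<close>

lemma cnj_circle_point: "cnj (circle_point t) = circle_point (- t)"
  by (simp add: circle_point_def)

lemma sphere_eq_circle_points: "sphere 0 1 = insert (-1) (range circle_point)"
proof (intro equalityI subsetI)
  fix \<zeta> :: complex assume "\<zeta> \<in> sphere 0 1"
  then have n: "(Re \<zeta>)\<^sup>2 + (Im \<zeta>)\<^sup>2 = 1"
    by (simp add: cmod_def)
  show "\<zeta> \<in> insert (-1) (range circle_point)"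
  proof (cases "\<zeta> = -1")
    case False
    then have Re: "Re \<zeta> \<noteq> -1"
      using n by (auto simp: complex_eq_iff)
    \<comment> \<open>The tangent of half the argument of \<open>\<zeta>\<close>.\<close>
    define t where "t = Im \<zeta> / (1 + Re \<zeta>)"
    have t: "t * (1 + Re \<zeta>) = Im \<zeta>"
      using Re by (simp add: t_def field_simps)
    have "(t * Im \<zeta>) * (1 + Re \<zeta>) = Im \<zeta> * Im \<zeta>"
      using t by (metis mult.assoc mult.commute)
    also have "\<dots> = (1 - Re \<zeta>) * (1 + Re \<zeta>)"
      using n by (simp add: algebra_simps power2_eq_square)
    finally have t2: "t * Im \<zeta> = 1 - Re \<zeta>"
      using Re by (simp add: mult_right_cancel)
    have "\<zeta> * (1 - \<i> * of_real t) = 1 + \<i> * of_real t"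
      using t t2 by (simp add: complex_eq_iff algebra_simps)
    then have "\<zeta> = circle_point t"
      unfolding circle_point_def using cayley_denominator[of t] by (simp add: eq_divide_eq)
    then show ?thesis by blast
  qed auto
qed (auto simp: norm_circle_point)

lemma cayley_at_minus_one: "filterlim cayley at_infinity (at (-1))"
proof -
  have "filterlim (\<lambda>\<zeta>. (\<i> * (1 - \<zeta>)) / (1 + \<zeta>)) at_infinity (at (-1))"
  proof (rule filterlim_divide_at_infinity[of _ "2 * \<i>"])
    show "((\<lambda>\<zeta>. \<i> * (1 - \<zeta>)) \<longlongrightarrow> 2 * \<i>) (at (-1))"
      by (auto intro!: tendsto_eq_intros)
    show "filterlim (\<lambda>\<zeta>::complex. 1 + \<zeta>) (at 0) (at (-1))"
      by (rule filterlim_atI) (auto intro!: tendsto_eq_intros simp: eventually_at_filter add_eq_0_iff)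
  qed auto
  then show ?thesis by (simp add: cayley_def[abs_def])
qed

text \<open>The number \<open>\<i> * \<zeta> * F'\<close> is the derivative at angle 0 of
  \<open>F\<close> along the circle through \<open>\<zeta>\<close>, and \<open>F\<close> is real
  there.\<close>

lemma deriv_real_on_circle:
  assumes F: "(F has_field_derivative F') (at \<zeta>)" and \<zeta>: "cmod \<zeta> = 1"
    and real: "\<And>w. cmod w = 1 \<Longrightarrow> Im (F w) = 0"
  shows "Im (\<i> * \<zeta> * F') = 0"
proof -
  have e: "((\<lambda>\<theta>. \<zeta> * cis \<theta>) has_vector_derivative \<zeta> * \<i>) (at 0)"
    unfolding cis_conv_exp
    by (rule has_vector_derivative_real_field[of "\<lambda>w. \<zeta> * exp (\<i> * w)"])
      (auto intro!: derivative_eq_intros)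
  have "((\<lambda>\<theta>. F (\<zeta> * cis \<theta>)) has_vector_derivative (\<zeta> * \<i>) * F') (at 0)"
    using field_vector_diff_chain_at[of "\<lambda>\<theta>. \<zeta> * cis \<theta>" "\<zeta> * \<i>" 0 F F'] e F by (simp add: o_def)
  then have "((\<lambda>\<theta>. Im (F (\<zeta> * cis \<theta>))) has_real_derivative Im ((\<zeta> * \<i>) * F')) (at 0)"
    unfolding has_vector_derivative_complex_iff by blast
  moreover have "(\<lambda>\<theta>. Im (F (\<zeta> * cis \<theta>))) = (\<lambda>_. 0)"
    using \<zeta> by (auto simp: fun_eq_iff norm_mult intro!: real)
  ultimately have "Im ((\<zeta> * \<i>) * F') = 0"
    using DERIV_unique[OF _ DERIV_const] by metis
  then show ?thesis by (simp add: mult.commute)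
qed

section \<open>The generating function in the circle coordinate\<close>

lemma generating_function_real:
  assumes "generating_function f \<beta>\<^sub>0 \<beta>\<^sub>1"
  shows "Im (f (of_real t)) = 0"
proof -
  obtain U where "\<real> \<subseteq> U" "\<And>t. t \<in> U \<Longrightarrow> f (cnj t) = cnj (f t)"
    using assms unfolding generating_function_def by blast
  then have "f (cnj (of_real t)) = cnj (f (of_real t))"
    using Reals_of_real by blast
  then show ?thesis by (simp add: complex_eq_iff)
qed

text \<open>Multiplied by t, the remainder of the expansion is still O(1/t), which isolates the
  first coefficient; dividing by t again gives the limit of \<open>f\<close>. That limit is real
  because it can be taken along the positive reals.\<close>

lemma generating_function_at_infinity:
  assumes "generating_function f \<beta>\<^sub>0 \<beta>\<^sub>1"
  shows "(f \<longlongrightarrow> \<beta>\<^sub>0) at_infinity" "((\<lambda>t. t * (f t - \<beta>\<^sub>0)) \<longlongrightarrow> of_real \<beta>\<^sub>1) at_infinity"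
    "Im \<beta>\<^sub>0 = 0"
proof -
  let ?R = "\<lambda>t. f t - (\<beta>\<^sub>0 + of_real \<beta>\<^sub>1 / t)"
  have "?R \<in> O[at_infinity](\<lambda>t. 1 / t\<^sup>2)"
    using assms unfolding generating_function_def by blast
  then obtain c where c: "\<forall>\<^sub>F t in at_infinity. cmod (?R t) \<le> c * cmod (1 / t\<^sup>2)"
    by (rule landau_o.bigE)
  have inv: "((\<lambda>t::complex. 1 / t) \<longlongrightarrow> 0) at_infinity"
    using tendsto_inverse_0 by (simp add: inverse_eq_divide[symmetric])
  have lim: "((\<lambda>t. t * ?R t) \<longlongrightarrow> 0) at_infinity"
  proof (rule Lim_null_comparison)
    show "\<forall>\<^sub>F t in at_infinity. cmod (t * ?R t) \<le> c * cmod (1 / t)"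
      using c
    proof eventually_elim
      case (elim t)
      then show ?case
      proof (cases "t = 0")
        case False
        have "cmod (t * ?R t) \<le> cmod t * (c * cmod (1 / t\<^sup>2))"
          unfolding norm_mult by (rule mult_left_mono[OF elim]) simp
        also have "\<dots> = c * cmod (1 / t)"
          using False by (simp add: norm_divide norm_mult power2_eq_square field_simps)
        finally show ?thesis .
      qed simp
    qed
    show "((\<lambda>t. c * cmod (1 / t)) \<longlongrightarrow> 0) at_infinity"
      using tendsto_mult_right_zero[OF tendsto_norm_zero[OF inv]] .
  qed
  have "((\<lambda>t. t * ?R t + of_real \<beta>\<^sub>1) \<longlongrightarrow> 0 + of_real \<beta>\<^sub>1) at_infinity"
    by (intro tendsto_intros lim)
  moreover have "\<forall>\<^sub>F t in at_infinity. t * ?R t + of_real \<beta>\<^sub>1 = t * (f t - \<beta>\<^sub>0)"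
    using eventually_not_equal_at_infinity[of 0] by eventually_elim (simp add: field_simps)
  ultimately show 2: "((\<lambda>t. t * (f t - \<beta>\<^sub>0)) \<longlongrightarrow> of_real \<beta>\<^sub>1) at_infinity"
    by (simp add: tendsto_cong)
  have "((\<lambda>t. (1 / t) * (t * (f t - \<beta>\<^sub>0)) + \<beta>\<^sub>0) \<longlongrightarrow> 0 * of_real \<beta>\<^sub>1 + \<beta>\<^sub>0) at_infinity"
    by (intro tendsto_intros inv 2)
  moreover have "\<forall>\<^sub>F t in at_infinity. (1 / t) * (t * (f t - \<beta>\<^sub>0)) + \<beta>\<^sub>0 = f t"
    using eventually_not_equal_at_infinity[of 0] by eventually_elim simp
  ultimately show 1: "(f \<longlongrightarrow> \<beta>\<^sub>0) at_infinity"
    by (simp add: tendsto_cong)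
  have "filterlim (of_real :: real \<Rightarrow> complex) at_infinity at_top"
    by (rule filterlim_of_real_at_infinity)
  then have "((\<lambda>x::real. f (of_real x)) \<longlongrightarrow> \<beta>\<^sub>0) at_top"
    using filterlim_compose[OF 1] by blast
  then have "((\<lambda>x::real. Im (f (of_real x))) \<longlongrightarrow> Im \<beta>\<^sub>0) at_top"
    by (rule tendsto_Im)
  then have "((\<lambda>x::real. 0) \<longlongrightarrow> Im \<beta>\<^sub>0) at_top"
    using generating_function_real[OF assms] by simp
  then show "Im \<beta>\<^sub>0 = 0"
    using tendsto_unique[OF _ tendsto_const] trivial_limit_at_top_linorder by metis
qed

definition circle_lift :: "(complex \<Rightarrow> complex) \<Rightarrow> complex \<Rightarrow> complex \<Rightarrow> complex" where
  "circle_lift f \<beta>\<^sub>0 \<zeta> = (if \<zeta> = -1 then \<beta>\<^sub>0 else f (cayley \<zeta>))"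

lemma circle_lift_circle_point: "circle_lift f \<beta>\<^sub>0 (circle_point t) = f (of_real t)"
  by (simp add: circle_lift_def circle_point_ne cayley_circle_point)

lemma circle_lift_real:
  assumes "generating_function f \<beta>\<^sub>0 \<beta>\<^sub>1" "cmod \<zeta> = 1"
  shows "Im (circle_lift f \<beta>\<^sub>0 \<zeta>) = 0"
proof -
  have "\<zeta> \<in> insert (-1) (range circle_point)"
    using assms(2) sphere_eq_circle_points by (metis dist_0_norm mem_sphere)
  then show ?thesis
    using generating_function_real[OF assms(1)] generating_function_at_infinity(3)[OF assms(1)]
    by (auto simp: circle_lift_circle_point) (simp add: circle_lift_def)
qed

text \<open>A circle point distinct from its conjugate is neither 1 nor -1, so it comes from a
  finite nonzero t.\<close>

lemma circle_lift_cnj: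
  assumes "generating_function f \<beta>\<^sub>0 \<beta>\<^sub>1" "cmod \<zeta> = 1" "\<zeta> \<noteq> cnj \<zeta>"
  shows "circle_lift f \<beta>\<^sub>0 \<zeta> \<noteq> circle_lift f \<beta>\<^sub>0 (cnj \<zeta>)"
proof -
  have "\<zeta> \<in> insert (-1) (range circle_point)"
    using assms(2) sphere_eq_circle_points by (metis dist_0_norm mem_sphere)
  then obtain t where t: "\<zeta> = circle_point t"
    using assms(3) by auto
  then have "t \<noteq> 0"
    using assms(3) cnj_circle_point by fastforce
  then show ?thesis
    using assms(1) unfolding t cnj_circle_point circle_lift_circle_point generating_function_def by blast
qed

text \<open>Near -1 the values of \<open>cayley\<close> are large, hence in the domain of
  \<open>f\<close>; the singularity at -1 is removable because \<open>f\<close> has the limit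
  \<open>\<beta>\<^sub>0\<close> at infinity.\<close>

lemma circle_lift_holomorphic:
  assumes "generating_function f \<beta>\<^sub>0 \<beta>\<^sub>1"
  obtains A where "open A" "sphere 0 1 \<subseteq> A" "circle_lift f \<beta>\<^sub>0 holomorphic_on A"
proof -
  obtain U where U: "open U" "\<real> \<subseteq> U" "\<forall>\<^sub>F t in at_infinity. t \<in> U" "f holomorphic_on U"
    using assms unfolding generating_function_def by blast
  define A0 where "A0 = (- {-1}) \<inter> cayley -` U"
  have ch: "cayley holomorphic_on (- {-1})"
    unfolding cayley_def[abs_def] by (auto intro!: holomorphic_intros simp: add_eq_0_iff)
  have A0: "open A0"
    unfolding A0_def
    by (rule continuous_open_preimage[OF holomorphic_on_imp_continuous_on[OF ch] _ U(1)]) auto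
  have ev: "\<forall>\<^sub>F \<zeta> in at (-1). \<zeta> \<in> A0"
    using eventually_neq_at_within[of "-1" "-1" UNIV]
      eventually_compose_filterlim[OF U(3) cayley_at_minus_one]
    by eventually_elim (simp add: A0_def)
  then obtain S where S: "open S" "-1 \<in> S" "\<And>\<zeta>. \<zeta> \<in> S \<Longrightarrow> \<zeta> \<noteq> -1 \<Longrightarrow> \<zeta> \<in> A0"
    unfolding eventually_at_topological by blast
  define A where "A = A0 \<union> S"
  have A: "open A" "-1 \<in> A" "A - {-1} = A0"
    using A0 S by (auto simp: A_def A0_def)
  have hol: "circle_lift f \<beta>\<^sub>0 holomorphic_on A - {-1}"
  proof -
    have "(f \<circ> cayley) holomorphic_on A0"
      by (rule holomorphic_on_compose_gen[OF holomorphic_on_subset[OF ch] U(4)]) (auto simp: A0_def)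
    then show ?thesis
      unfolding A(3) by (rule holomorphic_transform) (auto simp: A0_def circle_lift_def)
  qed
  have lim: "(circle_lift f \<beta>\<^sub>0 \<longlongrightarrow> circle_lift f \<beta>\<^sub>0 z) (at z within A)" if z: "z \<in> {-1}" for z
  proof -
    have "((\<lambda>\<zeta>. f (cayley \<zeta>)) \<longlongrightarrow> \<beta>\<^sub>0) (at (-1))"
      by (rule filterlim_compose[OF generating_function_at_infinity(1)[OF assms] cayley_at_minus_one])
    moreover have "\<forall>\<^sub>F \<zeta> in at (-1). f (cayley \<zeta>) = circle_lift f \<beta>\<^sub>0 \<zeta>"
      by (rule eventually_mono[OF eventually_neq_at_within[of "-1"]]) (simp add: circle_lift_def)
    ultimately have "(circle_lift f \<beta>\<^sub>0 \<longlongrightarrow> \<beta>\<^sub>0) (at (-1))"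
      by (simp add: tendsto_cong)
    then show ?thesis
      using z at_within_open[OF A(2,1)] by (simp add: circle_lift_def)
  qed
  have "circle_lift f \<beta>\<^sub>0 holomorphic_on A"
    by (rule no_isolated_singularity'[OF lim hol A(1)]) simp_all
  moreover have "sphere 0 1 \<subseteq> A"
  proof -
    have "circle_point t \<in> A0" for t
      using U(2) by (auto simp: A0_def circle_point_ne cayley_circle_point)
    then show ?thesis
      unfolding sphere_eq_circle_points using A(2) by (auto simp: A_def)
  qed
  ultimately show ?thesis
    using that A(1) by blast
qed

text \<open>These are the points t = 0 and t = infinity: at the first the derivative is a multiple
  of \<open>deriv f 0\<close>, at the second a multiple of \<open>\<beta>\<^sub>1\<close>.\<close>

lemma circle_lift_deriv_nonzero:
  assumes "generating_function f \<beta>\<^sub>0 \<beta>\<^sub>1" "\<zeta> = 1 \<or> \<zeta> = -1"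
    and der: "(circle_lift f \<beta>\<^sub>0 has_field_derivative F') (at \<zeta>)"
  shows "F' \<noteq> 0"
  using assms(2)
proof
  assume \<zeta>: "\<zeta> = 1"
  obtain U where U: "open U" "\<real> \<subseteq> U" "f holomorphic_on U"
    using assms(1) unfolding generating_function_def by blast
  have "(f has_field_derivative deriv f 0) (at (cayley 1))"
    using holomorphic_derivI[OF U(3,1), of 0] U(2) by (auto simp: cayley_def)
  moreover have "(cayley has_field_derivative (- \<i> / 2)) (at 1)"
    unfolding cayley_def[abs_def] by (auto intro!: derivative_eq_intros)
  ultimately have "((\<lambda>\<zeta>. f (cayley \<zeta>)) has_field_derivative deriv f 0 * (- \<i> / 2)) (at 1)"
    by (rule DERIV_chain2)
  then have "(circle_lift f \<beta>\<^sub>0 has_field_derivative deriv f 0 * (- \<i> / 2)) (at 1)"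
    by (rule has_field_derivative_transform_within_open[of _ _ _ "- {-1}"]) (auto simp: circle_lift_def)
  then have "F' = deriv f 0 * (- \<i> / 2)"
    using der \<zeta> DERIV_unique by blast
  then show ?thesis
    using assms(1) unfolding generating_function_def by simp
next
  assume \<zeta>: "\<zeta> = -1"
  have lim: "((\<lambda>\<zeta>. (circle_lift f \<beta>\<^sub>0 \<zeta> - \<beta>\<^sub>0) / (\<zeta> - (-1))) \<longlongrightarrow> F') (at (-1))"
    using der unfolding \<zeta> has_field_derivative_iff by (simp add: circle_lift_def)
  \<comment> \<open>The factor turns t into 1/(zeta + 1), so t times the deviation of f from its
    limit becomes the difference quotient at -1.\<close>
  have "((\<lambda>\<zeta>. (cayley \<zeta> * (f (cayley \<zeta>) - \<beta>\<^sub>0)) * (- \<i> / (1 - \<zeta>))) \<longlongrightarrow> of_real \<beta>\<^sub>1 * (- \<i> / 2)) (at (-1))"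
    by (intro tendsto_mult filterlim_compose[OF generating_function_at_infinity(2)[OF assms(1)] cayley_at_minus_one])
      (auto intro!: tendsto_eq_intros)
  moreover have "\<forall>\<^sub>F \<zeta> in at (-1). (cayley \<zeta> * (f (cayley \<zeta>) - \<beta>\<^sub>0)) * (- \<i> / (1 - \<zeta>))
      = (circle_lift f \<beta>\<^sub>0 \<zeta> - \<beta>\<^sub>0) / (\<zeta> - (-1))"
  proof -
    have "\<forall>\<^sub>F \<zeta>::complex in at (-1). \<zeta> \<noteq> 1 \<and> \<zeta> \<noteq> -1"
      by (intro eventually_conj eventually_neq_at_within)
    then show ?thesis
    proof eventually_elim
      case (elim \<zeta>)
      then have nz: "1 - \<zeta> \<noteq> 0" "1 + \<zeta> \<noteq> 0"
        by (auto simp: add_eq_0_iff)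
      then have "cayley \<zeta> * (- \<i> / (1 - \<zeta>)) = 1 / (1 + \<zeta>)"
        by (simp add: cayley_def)
      then have "(cayley \<zeta> * (f (cayley \<zeta>) - \<beta>\<^sub>0)) * (- \<i> / (1 - \<zeta>)) = (f (cayley \<zeta>) - \<beta>\<^sub>0) * (1 / (1 + \<zeta>))"
        by (metis mult.assoc mult.commute)
      then show ?case
        using elim by (simp add: circle_lift_def add.commute)
    qed
  qed
  ultimately have "((\<lambda>\<zeta>. (circle_lift f \<beta>\<^sub>0 \<zeta> - \<beta>\<^sub>0) / (\<zeta> - (-1))) \<longlongrightarrow> of_real \<beta>\<^sub>1 * (- \<i> / 2)) (at (-1))"
    by (rule Lim_transform_eventually)
  then have "F' = of_real \<beta>\<^sub>1 * (- \<i> / 2)"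
    by (rule tendsto_unique[OF trivial_limit_at lim])
  then show ?thesis
    using assms(1) unfolding generating_function_def by simp
qed

section \<open>The holomorphic chart around the boundary curve\<close>

definition joukowski :: "complex \<Rightarrow> complex" where
  "joukowski \<zeta> = (\<zeta> + 1 / \<zeta>) / 2"

lemma joukowski_circle: "cmod \<zeta> = 1 \<Longrightarrow> joukowski \<zeta> = of_real (Re \<zeta>)"
proof -
  assume "cmod \<zeta> = 1"
  then have "1 / \<zeta> = cnj \<zeta>"
    by (simp add: divide_conv_cnj)
  then show ?thesis
    by (simp add: joukowski_def complex_add_cnj)
qed

lemma joukowski_holomorphic: "0 \<notin> A \<Longrightarrow> joukowski holomorphic_on A"
  unfolding joukowski_def[abs_def] by (auto intro!: holomorphic_intros)

lemma joukowski_derivative: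
  "\<zeta> \<noteq> 0 \<Longrightarrow> (joukowski has_field_derivative (1 - 1 / \<zeta>\<^sup>2) / 2) (at \<zeta>)"
  unfolding joukowski_def[abs_def]
  by (auto intro!: derivative_eq_intros simp: power2_eq_square)

text \<open>Provides a connected neighbourhood of the circle, as required for the zeros of a
  nonconstant holomorphic function to be isolated.\<close>

lemma sphere_in_open_annulus:
  fixes A :: "complex set"
  assumes "open A" "sphere 0 1 \<subseteq> A"
  obtains B where "open B" "connected B" "sphere 0 1 \<subseteq> B" "B \<subseteq> A"
proof -
  obtain e where e: "e > 0" "(\<Union>x\<in>sphere 0 1. ball x e) \<subseteq> A"
    using compact_subset_open_imp_ball_epsilon_subset[OF compact_sphere assms] .
  \<comment> \<open>The bound 1 keeps the origin out of the annulus, so that the radial projection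
    \<open>sgn z\<close> lies on the circle.\<close>
  define d where "d = min e 1"
  define B :: "complex set" where "B = {z. 1 - d < norm (z - 0) \<and> norm (z - 0) < 1 + d}"
  have "d > 0" using e(1) by (simp add: d_def)
  show ?thesis
  proof
    show "open B"
      unfolding B_def by (intro open_Collect_conj open_Collect_less continuous_intros)
    show "connected B"
      unfolding B_def by (rule connected_annulus) simp
    show "sphere 0 1 \<subseteq> B"
      using \<open>d > 0\<close> by (auto simp: B_def)
    show "B \<subseteq> A"
    proof
      fix z assume "z \<in> B"
      then have z: "\<bar>1 - cmod z\<bar> < d" "z \<noteq> 0"
        by (auto simp: B_def d_def)
      have "sgn z - z = (1 - of_real (cmod z)) * sgn z"
        using z(2) by (simp add: sgn_eq field_simps)
      then have "dist (sgn z) z = \<bar>1 - cmod z\<bar>"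
        using z(2) by (metis dist_norm mult.right_neutral norm_mult norm_of_real norm_sgn of_real_1 of_real_diff)
      then have "z \<in> ball (sgn z) e"
        using z(1) by (simp add: d_def)
      moreover have "sgn z \<in> sphere 0 1"
        using z(2) by (simp add: norm_sgn)
      ultimately show "z \<in> A"
        using e(2) by blast
    qed
  qed
qed

text \<open>The map Z of the overview, with \<open>a\<close> for gamma1 and \<open>c\<close> for the
  real part of gamma2. Writing the height as \<open>joukowski\<close> makes the formula holomorphic
  off the circle as well.\<close>

definition circle_chart :: "(complex \<Rightarrow> complex) \<Rightarrow> complex \<Rightarrow> real \<Rightarrow> real \<Rightarrow> complex \<Rightarrow> complex" where
  "circle_chart f \<beta>\<^sub>0 a c \<zeta>
    = of_real a * circle_lift f \<beta>\<^sub>0 \<zeta> + of_real c * joukowski \<zeta> + \<i> * joukowski \<zeta>"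

lemma generated_curve_eq_image:
  "generated_curve f \<beta>\<^sub>0 = (\<lambda>\<zeta>. Complex (Re (circle_lift f \<beta>\<^sub>0 \<zeta>)) (Re \<zeta>)) ` sphere 0 1"
proof -
  have "circle_lift f \<beta>\<^sub>0 (-1) = \<beta>\<^sub>0"
    by (simp add: circle_lift_def)
  then show ?thesis
    unfolding sphere_eq_circle_points generated_curve_def
    by (simp add: image_image circle_lift_circle_point Re_circle_point)
qed

context
  fixes f :: "complex \<Rightarrow> complex" and \<beta>\<^sub>0 :: complex and \<beta>\<^sub>1 a c :: real
  assumes gen: "generating_function f \<beta>\<^sub>0 \<beta>\<^sub>1" and a: "a \<noteq> 0"
begin

lemma circle_chart_on_circle:
  assumes "cmod \<zeta> = 1"
  shows "circle_chart f \<beta>\<^sub>0 a c \<zeta> = Complex (a * Re (circle_lift f \<beta>\<^sub>0 \<zeta>) + c * Re \<zeta>) (Re \<zeta>)"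
  using circle_lift_real[OF gen assms] joukowski_circle[OF assms]
  by (simp add: circle_chart_def complex_eq_iff)

lemma sheared_curve_eq_image:
  "{Complex (a * x + c * y) y | x y. Complex x y \<in> generated_curve f \<beta>\<^sub>0}
    = circle_chart f \<beta>\<^sub>0 a c ` sphere 0 1"
proof -
  have "circle_chart f \<beta>\<^sub>0 a c ` sphere 0 1
      = (\<lambda>\<zeta>. Complex (a * Re (circle_lift f \<beta>\<^sub>0 \<zeta>) + c * Re \<zeta>) (Re \<zeta>)) ` sphere 0 1"
    by (rule image_cong) (auto simp: circle_chart_on_circle)
  then show ?thesis
    unfolding generated_curve_eq_image by (auto simp: image_iff)
qed

text \<open>Equal imaginary parts leave only equal or conjugate circle points; after removing the
  shear and dividing by \<open>a\<close>, the conjugate case contradicts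
  \<open>circle_lift_cnj\<close>.\<close>

lemma circle_chart_inj: "inj_on (circle_chart f \<beta>\<^sub>0 a c) (sphere 0 1)"
proof (rule inj_onI)
  fix \<zeta> \<xi> :: complex
  assume "\<zeta> \<in> sphere 0 1" "\<xi> \<in> sphere 0 1"
    and eq: "circle_chart f \<beta>\<^sub>0 a c \<zeta> = circle_chart f \<beta>\<^sub>0 a c \<xi>"
  then have n: "cmod \<zeta> = 1" "cmod \<xi> = 1" by auto
  have Re: "Re \<zeta> = Re \<xi>"
    using eq unfolding circle_chart_on_circle[OF n(1)] circle_chart_on_circle[OF n(2)] by simp
  have "Re (circle_lift f \<beta>\<^sub>0 \<zeta>) = Re (circle_lift f \<beta>\<^sub>0 \<xi>)"
    using eq Re a unfolding circle_chart_on_circle[OF n(1)] circle_chart_on_circle[OF n(2)] by simp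
  then have F: "circle_lift f \<beta>\<^sub>0 \<zeta> = circle_lift f \<beta>\<^sub>0 \<xi>"
    using circle_lift_real[OF gen n(1)] circle_lift_real[OF gen n(2)] by (simp add: complex_eq_iff)
  have "(Re \<zeta>)\<^sup>2 + (Im \<zeta>)\<^sup>2 = (Re \<xi>)\<^sup>2 + (Im \<xi>)\<^sup>2"
    using n by (simp add: cmod_power2[symmetric])
  then have "Im \<zeta> = Im \<xi> \<or> Im \<zeta> = - Im \<xi>"
    using Re by (simp add: power2_eq_iff)
  then have "\<zeta> = \<xi> \<or> \<xi> = cnj \<zeta>"
    using Re by (auto simp: complex_eq_iff)
  then show "\<zeta> = \<xi>"
    using circle_lift_cnj[OF gen n(1)] F by metis
qed

text \<open>Along the circle both coordinates of the curve are real, so a vanishing derivative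
  forces the derivative of the height, \<open>- Im \<zeta>\<close>, to vanish. This leaves the
  points 1 and -1, where only the term with \<open>F'\<close> survives.\<close>

lemma circle_chart_deriv_nonzero:
  assumes \<zeta>: "cmod \<zeta> = 1" and F: "(circle_lift f \<beta>\<^sub>0 has_field_derivative F') (at \<zeta>)"
  shows "deriv (circle_chart f \<beta>\<^sub>0 a c) \<zeta> \<noteq> 0"
proof
  assume 0: "deriv (circle_chart f \<beta>\<^sub>0 a c) \<zeta> = 0"
  define J' where "J' = (1 - 1 / \<zeta>\<^sup>2) / 2"
  have "\<zeta> \<noteq> 0" using \<zeta> by auto
  have J: "(joukowski has_field_derivative J') (at \<zeta>)"
    unfolding J'_def using joukowski_derivative[OF \<open>\<zeta> \<noteq> 0\<close>] .
  have "(circle_chart f \<beta>\<^sub>0 a c has_field_derivative (of_real a * F' + of_real c * J' + \<i> * J')) (at \<zeta>)"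
    unfolding circle_chart_def[abs_def] by (intro DERIV_add DERIV_cmult F J)
  then have eq: "of_real a * F' + of_real c * J' + \<i> * J' = 0"
    using 0 DERIV_imp_deriv by metis
  have "\<zeta> * J' = (\<zeta> - 1 / \<zeta>) / 2"
    using \<open>\<zeta> \<noteq> 0\<close> by (simp add: J'_def field_simps power2_eq_square)
  moreover have "1 / \<zeta> = cnj \<zeta>"
    using \<zeta> by (simp add: divide_conv_cnj)
  \<comment> \<open>The derivative of the real part of \<open>\<zeta> * cis \<theta>\<close> at
    angle 0.\<close>
  ultimately have J2: "\<i> * \<zeta> * J' = - of_real (Im \<zeta>)"
    by (simp add: complex_eq_iff mult.assoc)
  have "of_real a * (\<i> * \<zeta> * F') + of_real c * (\<i> * \<zeta> * J') + \<i> * (\<i> * \<zeta> * J')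
      = \<i> * \<zeta> * (of_real a * F' + of_real c * J' + \<i> * J')"
    by (simp add: algebra_simps)
  also have "\<dots> = 0" unfolding eq by simp
  finally have "Im (of_real a * (\<i> * \<zeta> * F') + of_real c * (\<i> * \<zeta> * J') + \<i> * (\<i> * \<zeta> * J')) = 0"
    by simp
  then have "Im \<zeta> = 0"
    unfolding J2 using deriv_real_on_circle[OF F \<zeta> circle_lift_real[OF gen]] by simp
  moreover have "(Re \<zeta>)\<^sup>2 + (Im \<zeta>)\<^sup>2 = 1"
    using \<zeta> by (simp add: cmod_power2[symmetric])
  ultimately have "\<zeta> = 1 \<or> \<zeta> = -1"
    by (auto simp: complex_eq_iff power2_eq_1_iff)
  then have "J' = 0" "F' \<noteq> 0"
    using circle_lift_deriv_nonzero[OF gen _ F] by (auto simp: J'_def)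
  then show False
    using eq a by simp
qed

lemma circle_chart_horizontal_finite:
  "finite {x. Complex x y \<in> circle_chart f \<beta>\<^sub>0 a c ` sphere 0 1}"
proof (rule finite_subset)
  let ?s = "sqrt (1 - y\<^sup>2)"
  show "{x. Complex x y \<in> circle_chart f \<beta>\<^sub>0 a c ` sphere 0 1}
      \<subseteq> (\<lambda>\<zeta>. Re (circle_chart f \<beta>\<^sub>0 a c \<zeta>)) ` {Complex y ?s, Complex y (- ?s)}"
  proof
    fix x assume "x \<in> {x. Complex x y \<in> circle_chart f \<beta>\<^sub>0 a c ` sphere 0 1}"
    then obtain \<zeta> where \<zeta>: "cmod \<zeta> = 1" "Complex x y = circle_chart f \<beta>\<^sub>0 a c \<zeta>"
      by auto
    have Re: "Re \<zeta> = y"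
      using \<zeta>(2) unfolding circle_chart_on_circle[OF \<zeta>(1)] by simp
    have "(Re \<zeta>)\<^sup>2 + (Im \<zeta>)\<^sup>2 = 1"
      using \<zeta>(1) by (simp add: cmod_power2[symmetric])
    then have "(Im \<zeta>)\<^sup>2 = 1 - y\<^sup>2"
      using Re by simp
    then have "?s = \<bar>Im \<zeta>\<bar>"
      by (metis real_sqrt_abs)
    then have "\<zeta> \<in> {Complex y ?s, Complex y (- ?s)}"
      using Re by (auto simp: complex_eq_iff)
    moreover have "x = Re (circle_chart f \<beta>\<^sub>0 a c \<zeta>)"
      using \<zeta>(2) by (metis complex.sel(1))
    ultimately show "x \<in> (\<lambda>\<zeta>. Re (circle_chart f \<beta>\<^sub>0 a c \<zeta>)) ` {Complex y ?s, Complex y (- ?s)}"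
      by blast
  qed
qed simp

text \<open>The abscissa is the restriction to the circle of a holomorphic function, and a
  nonconstant one takes the value \<open>x\<close> only finitely often on a compact set.\<close>

lemma circle_chart_vertical_finite:
  "finite {y. Complex x y \<in> circle_chart f \<beta>\<^sub>0 a c ` sphere 0 1}"
proof -
  obtain A where A: "open A" "sphere 0 1 \<subseteq> A" "circle_lift f \<beta>\<^sub>0 holomorphic_on A"
    using circle_lift_holomorphic[OF gen] .
  have "open (A - {0})" "sphere 0 1 \<subseteq> A - {0}"
    using A by auto
  then obtain B where B: "open B" "connected B" "sphere 0 1 \<subseteq> B" "B \<subseteq> A - {0}"
    using sphere_in_open_annulus by blast
  define Q where "Q = (\<lambda>\<zeta>. of_real a * circle_lift f \<beta>\<^sub>0 \<zeta> + of_real c * joukowski \<zeta> - of_real x)"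
  have "Q holomorphic_on B"
    unfolding Q_def using B(4)
    by (intro holomorphic_intros joukowski_holomorphic holomorphic_on_subset[OF A(3)]) auto
  moreover have "\<not> Q constant_on B"
  proof
    assume "Q constant_on B"
    moreover have "\<i> \<in> B" "- \<i> \<in> B"
      using B(3) by auto
    \<comment> \<open>At these two points, t = 1 and t = -1, \<open>joukowski\<close> vanishes, so
      equality would mean that f agrees at 1 and -1.\<close>
    ultimately have "Q \<i> = Q (- \<i>)"
      unfolding constant_on_def by metis
    then have "circle_lift f \<beta>\<^sub>0 \<i> = circle_lift f \<beta>\<^sub>0 (cnj \<i>)"
      using a by (simp add: Q_def joukowski_def)
    then show False
      using circle_lift_cnj[OF gen, of \<i>] by (simp add: complex_eq_iff)
  qed
  ultimately have "finite {\<zeta> \<in> sphere 0 1. Q \<zeta> = 0}"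
    using holomorphic_compact_finite_zeros[OF _ B(1,2) compact_sphere B(3)] by blast
  moreover have "{y. Complex x y \<in> circle_chart f \<beta>\<^sub>0 a c ` sphere 0 1} \<subseteq> Re ` {\<zeta> \<in> sphere 0 1. Q \<zeta> = 0}"
  proof
    fix y assume "y \<in> {y. Complex x y \<in> circle_chart f \<beta>\<^sub>0 a c ` sphere 0 1}"
    then obtain \<zeta> where \<zeta>: "cmod \<zeta> = 1" "Complex x y = circle_chart f \<beta>\<^sub>0 a c \<zeta>"
      by auto
    then have "Q \<zeta> = 0" "y = Re \<zeta>"
      using circle_lift_real[OF gen \<zeta>(1)] joukowski_circle[OF \<zeta>(1)]
      by (auto simp: Q_def circle_chart_on_circle complex_eq_iff)
    then show "y \<in> Re ` {\<zeta> \<in> sphere 0 1. Q \<zeta> = 0}"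
      using \<zeta>(1) by auto
  qed
  ultimately show ?thesis
    by (meson finite_imageI finite_subset)
qed

lemma circle_chart_inverse:
  obtains N h where "open N" "circle_chart f \<beta>\<^sub>0 a c ` sphere 0 1 \<subseteq> N" "h holomorphic_on N"
    "\<And>z. z \<in> circle_chart f \<beta>\<^sub>0 a c ` sphere 0 1 \<Longrightarrow> h z = of_real (Im z)"
    "continuous_on (sphere 0 1) (circle_chart f \<beta>\<^sub>0 a c)"
proof -
  let ?Z = "circle_chart f \<beta>\<^sub>0 a c"
  obtain A where A: "open A" "sphere 0 1 \<subseteq> A" "circle_lift f \<beta>\<^sub>0 holomorphic_on A"
    using circle_lift_holomorphic[OF gen] .
  define A' where "A' = A - {0}"
  have A': "open A'" "sphere 0 1 \<subseteq> A'" "0 \<notin> A'" "A' \<subseteq> A"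
    using A by (auto simp: A'_def)
  have Z: "?Z holomorphic_on A'"
    unfolding circle_chart_def[abs_def] using A'(3,4)
    by (intro holomorphic_intros joukowski_holomorphic holomorphic_on_subset[OF A(3)]) auto
  have "deriv ?Z \<zeta> \<noteq> 0" if "\<zeta> \<in> sphere 0 1" for \<zeta>
    using circle_chart_deriv_nonzero[OF _ holomorphic_derivI[OF A(3,1)]] that A(2) by auto
  \<comment> \<open>Injectivity on a full neighbourhood of the circle is what makes the inverse, and
    with it \<open>h\<close>, available on both sides of the curve.\<close>
  then obtain M where M: "open M" "sphere 0 1 \<subseteq> M" "M \<subseteq> A'" "inj_on ?Z M"
    using inj_on_neighbourhood_of_compact[OF Z A'(1) compact_sphere A'(2) circle_chart_inj] by blast
  have ZM: "?Z holomorphic_on M"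
    using Z M(3) by (rule holomorphic_on_subset)
  obtain g where g: "g holomorphic_on ?Z ` M" "\<And>\<zeta>. \<zeta> \<in> M \<Longrightarrow> g (?Z \<zeta>) = \<zeta>"
    using holomorphic_has_inverse[OF ZM M(1,4)] by metis
  have "(joukowski \<circ> g) holomorphic_on ?Z ` M"
  proof (rule holomorphic_on_compose_gen[OF g(1)])
    show "joukowski holomorphic_on M"
      using M(3) A'(3) by (intro joukowski_holomorphic) auto
    show "g ` ?Z ` M \<subseteq> M" using g(2) by auto
  qed
  moreover have "open (?Z ` M)"
    by (rule open_mapping_thm3[OF ZM M(1,4)])
  moreover have "(joukowski \<circ> g) z = of_real (Im z)" if z: "z \<in> ?Z ` sphere 0 1" for z
  proof -
    obtain \<zeta> where \<zeta>: "\<zeta> \<in> sphere 0 1" "z = ?Z \<zeta>"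
      using z by blast
    then have "cmod \<zeta> = 1" "g z = \<zeta>"
      using g(2) M(2) by auto
    then show ?thesis
      using \<zeta>(2) by (simp add: joukowski_circle circle_chart_on_circle)
  qed
  moreover have "continuous_on (sphere 0 1) ?Z"
    using holomorphic_on_imp_continuous_on[OF Z] A'(2) continuous_on_subset by blast
  ultimately show ?thesis
    using that[of "?Z ` M" "joukowski \<circ> g"] M(2) by blast
qed

lemma circle_chart_jordan_curve:
  obtains p where "simple_path p" "pathfinish p = pathstart p"
    "path_image p = circle_chart f \<beta>\<^sub>0 a c ` sphere 0 1"
proof -
  let ?Z = "circle_chart f \<beta>\<^sub>0 a c"
  have cont: "continuous_on (sphere 0 1) ?Z"
    using circle_chart_inverse by metis
  have im: "path_image (circlepath 0 1) = sphere (0::complex) 1"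
    by simp
  show ?thesis
  proof
    show "simple_path (?Z \<circ> circlepath 0 1)"
      by (rule simple_path_continuous_image) (use cont circle_chart_inj in \<open>auto simp: simple_path_circlepath\<close>)
    show "pathfinish (?Z \<circ> circlepath 0 1) = pathstart (?Z \<circ> circlepath 0 1)"
      by (simp add: pathfinish_compose pathstart_compose)
    show "path_image (?Z \<circ> circlepath 0 1) = ?Z ` sphere 0 1"
      unfolding path_image_compose im ..
  qed
qed

lemma circle_chart_inclusion:
  "frontier (inside (circle_chart f \<beta>\<^sub>0 a c ` sphere 0 1)) = circle_chart f \<beta>\<^sub>0 a c ` sphere 0 1"
  "E_Omega_inclusion s (inside (circle_chart f \<beta>\<^sub>0 a c ` sphere 0 1))"
proof -
  obtain p where p: "simple_path p" "pathfinish p = pathstart p"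
    "path_image p = circle_chart f \<beta>\<^sub>0 a c ` sphere 0 1"
    using circle_chart_jordan_curve .
  show "frontier (inside (circle_chart f \<beta>\<^sub>0 a c ` sphere 0 1)) = circle_chart f \<beta>\<^sub>0 a c ` sphere 0 1"
    using Jordan_inside_outside[OF p(1,2)] unfolding p(3) by blast
  obtain N h where "open N" "circle_chart f \<beta>\<^sub>0 a c ` sphere 0 1 \<subseteq> N" "h holomorphic_on N"
    "\<And>z. z \<in> circle_chart f \<beta>\<^sub>0 a c ` sphere 0 1 \<Longrightarrow> h z = of_real (Im z)"
    using circle_chart_inverse by metis
  then show "E_Omega_inclusion s (inside (circle_chart f \<beta>\<^sub>0 a c ` sphere 0 1))"
    using E_Omega_inclusion_inside[OF p(1,2), unfolded p(3)] circle_chart_horizontal_finite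
      circle_chart_vertical_finite by blast
qed

end

text \<open>The unsheared case of the chart, stretch 1 and shear 0.\<close>

lemma frontier_generated_inclusion:
  assumes "generating_function f \<beta>\<^sub>0 \<beta>\<^sub>1"
  shows "frontier (generated_inclusion f \<beta>\<^sub>0) = generated_curve f \<beta>\<^sub>0"
proof -
  have "generated_curve f \<beta>\<^sub>0 = circle_chart f \<beta>\<^sub>0 1 0 ` sphere 0 1"
    unfolding sheared_curve_eq_image[OF assms one_neq_zero, of 0, symmetric]
    by (simp add: set_eq_iff) (metis complex_surj)
  then show ?thesis
    using circle_chart_inclusion(1)[OF assms one_neq_zero, of 0] by (simp add: generated_inclusion_def)
qed

section \<open>The maps near the slit\<close>

lemma t_map_power2: "(t_map h)\<^sup>2 = (1 - h) / (1 + h)"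
  by (simp only: t_map_def power_mult_distrib power2_csqrt power2_i mult_minus1 minus_minus)

lemma norm_t_map: "cmod (t_map h) = sqrt (cmod ((1 - h) / (1 + h)))"
  by (simp add: t_map_def norm_mult del: norm_divide)

lemma slit_quotient_at_minus_one: "filterlim (\<lambda>h::complex. (1 - h) / (1 + h)) at_infinity (at (-1))"
proof (rule filterlim_divide_at_infinity[of _ 2])
  show "((\<lambda>h::complex. 1 - h) \<longlongrightarrow> 2) (at (-1))"
    by (auto intro!: tendsto_eq_intros)
  show "filterlim (\<lambda>h::complex. 1 + h) (at 0) (at (-1))"
    by (rule filterlim_atI) (auto intro!: tendsto_eq_intros simp: eventually_at_filter add_eq_0_iff)
qed auto

text \<open>Only the modulus matters here, so the choice of branch does not intervene.\<close>

lemma t_map_at_minus_one: "filterlim t_map at_infinity (at (-1))"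
proof -
  have "filterlim (\<lambda>h::complex. cmod ((1 - h) / (1 + h))) at_top (at (-1))"
    using slit_quotient_at_minus_one by (rule filterlim_at_infinity_imp_norm_at_top)
  then have "filterlim (\<lambda>h. sqrt (cmod ((1 - h) / (1 + h)))) at_top (at (-1))"
    by (rule filterlim_compose[OF sqrt_at_top])
  then have "filterlim (\<lambda>h. cmod (t_map h)) at_top (at (-1))"
    by (simp add: norm_t_map[abs_def])
  then show ?thesis
    by (rule filterlim_norm_at_top_imp_at_infinity)
qed

text \<open>The map from h to (1 - h)/(1 + h) is an involution and sends the nonnegative reals into
  the slit; hence the branch cut is met only on the slit.\<close>

lemma slit_quotient_in_slit:
  assumes "h \<noteq> -1" "- ((1 - h) / (1 + h)) \<in> \<real>\<^sub>\<le>\<^sub>0"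
  shows "h \<in> slit"
proof -
  obtain q where q: "q \<ge> 0" "(1 - h) / (1 + h) = of_real q"
    using assms(2) by (metis nonpos_Reals_cases add.inverse_inverse neg_0_le_iff_le of_real_minus)
  have "1 + h \<noteq> 0" using assms(1) by (simp add: add_eq_0_iff)
  then have "1 - h = of_real q * (1 + h)"
    using q(2) by (simp add: divide_eq_eq)
  then have "h * (1 + of_real q) = 1 - of_real q"
    by (simp add: algebra_simps)
  moreover have "(1 + of_real q :: complex) \<noteq> 0"
    using q(1) by (simp add: complex_eq_iff)
  ultimately have "h = of_real ((1 - q) / (1 + q))"
    by (simp add: eq_divide_eq)
  moreover have "(1 - q) / (1 + q) \<in> {-1..1}"
    using q(1) by (simp add: field_simps)
  ultimately show ?thesis
    unfolding slit_def by blast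
qed

lemma t_map_holomorphic: "t_map holomorphic_on - slit"
proof -
  have "-1 \<in> slit"
    unfolding slit_def by (rule image_eqI[of _ _ "-1"]) auto
  then have "1 + h \<noteq> 0" "- ((1 - h) / (1 + h)) \<notin> \<real>\<^sub>\<le>\<^sub>0" if "h \<in> - slit" for h
    using that slit_quotient_in_slit[of h] by (auto simp: add_eq_0_iff simp del: minus_divide_left)
  then show ?thesis
    unfolding t_map_def[abs_def] by (intro holomorphic_intros) blast+
qed

lemma slit_quotient_real:
  fixes v :: real
  assumes "-1 < v" "v \<le> 1"
  shows "(1 - complex_of_real v) / (1 + complex_of_real v) = (of_real (sqrt ((1 - v) / (1 + v))))\<^sup>2"
proof -
  have "(1 - v) / (1 + v) = (sqrt ((1 - v) / (1 + v)))\<^sup>2"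
    using assms by simp
  then have "complex_of_real ((1 - v) / (1 + v)) = of_real ((sqrt ((1 - v) / (1 + v)))\<^sup>2)"
    by presburger
  then show ?thesis
    by simp
qed

lemma slit_quotient_tendsto:
  fixes v :: real
  assumes "-1 < v"
  shows "((\<lambda>h. (1 - h) / (1 + h)) \<longlongrightarrow> (1 - complex_of_real v) / (1 + complex_of_real v)) (at (of_real v))"
proof -
  have "1 + complex_of_real v \<noteq> 0"
    using assms by (simp add: complex_eq_iff)
  then show ?thesis
    by (auto intro!: tendsto_intros)
qed

text \<open>The square of \<open>t_map\<close> is continuous where \<open>t_map\<close> itself
  jumps. A value whose square is near \<open>t\<^sup>2\<close> is near \<open>t\<close> or near
  \<open>- t\<close>, and both lie in \<open>U\<close>; at -1 the neighbourhood of infinity is used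
  instead.\<close>

lemma t_map_near_slit:
  assumes U: "open U" "\<real> \<subseteq> U" "\<forall>\<^sub>F t in at_infinity. t \<in> U" and p: "p \<in> slit"
  shows "\<forall>\<^sub>F h in at p. t_map h \<in> U"
proof -
  obtain v where v: "p = of_real v" "-1 \<le> v" "v \<le> 1"
    using p unfolding slit_def by auto
  show ?thesis
  proof (cases "v = -1")
    case True
    then show ?thesis
      using eventually_compose_filterlim[OF U(3) t_map_at_minus_one] v(1) by simp
  next
    case False
    then have v1: "-1 < v" using v(2) by simp
    define t where "t = complex_of_real (sqrt ((1 - v) / (1 + v)))"
    have "t \<in> U" "- t \<in> U"
      using U(2) by (auto simp: t_def)
    then obtain e1 e2 where e12: "e1 > 0" "ball t e1 \<subseteq> U" "e2 > 0" "ball (- t) e2 \<subseteq> U"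
      using U(1) by (metis open_contains_ball)
    define e where "e = min e1 e2"
    have e: "e > 0" "ball t e \<subseteq> U" "ball (- t) e \<subseteq> U"
      using e12 by (auto simp: e_def)
    have "((\<lambda>h. (t_map h)\<^sup>2) \<longlongrightarrow> t\<^sup>2) (at p)"
      using slit_quotient_tendsto[OF v1] slit_quotient_real[OF v1 v(3)]
      by (simp add: t_map_power2 v(1) t_def)
    then have "\<forall>\<^sub>F h in at p. dist ((t_map h)\<^sup>2) (t\<^sup>2) < e\<^sup>2"
      by (rule tendstoD) (use e in simp)
    then show ?thesis
    proof eventually_elim
      case (elim h)
      have "(t_map h)\<^sup>2 - t\<^sup>2 = (t_map h - t) * (t_map h + t)"
        by (simp add: algebra_simps power2_eq_square)
      then have lt: "cmod (t_map h - t) * cmod (t_map h + t) < e * e"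
        using elim by (simp add: dist_norm norm_mult power2_eq_square)
      \<comment> \<open>If both factors were at least \<open>e\<close>, their product could not be
        below \<open>e * e\<close>.\<close>
      have "cmod (t_map h - t) < e \<or> cmod (t_map h + t) < e"
      proof (rule ccontr)
        assume "\<not> ?thesis"
        then have "e * e \<le> cmod (t_map h - t) * cmod (t_map h + t)"
          using e(1) by (intro mult_mono) auto
        then show False using lt by simp
      qed
      moreover have "dist t (t_map h) = cmod (t_map h - t)" "dist (- t) (t_map h) = cmod (t_map h + t)"
        by (simp_all add: dist_norm norm_minus_commute)
      ultimately show ?case
        using e(2,3) by (auto simp: subset_iff)
    qed
  qed
qed

lemma t_map_near_slit_open:
  assumes U: "open U" "\<real> \<subseteq> U" "\<forall>\<^sub>F t in at_infinity. t \<in> U"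
  obtains N where "open N" "slit \<subseteq> N" "t_map ` (N - slit) \<subseteq> U"
proof -
  have "\<exists>S. open S \<and> p \<in> S \<and> (\<forall>h\<in>S. h \<noteq> p \<longrightarrow> t_map h \<in> U)" if "p \<in> slit" for p
    using t_map_near_slit[OF U that] unfolding eventually_at_topological by blast
  then obtain S where S: "\<And>p. p \<in> slit \<Longrightarrow> open (S p)" "\<And>p. p \<in> slit \<Longrightarrow> p \<in> S p"
    "\<And>p h. p \<in> slit \<Longrightarrow> h \<in> S p \<Longrightarrow> h \<noteq> p \<Longrightarrow> t_map h \<in> U"
    by metis
  show ?thesis
    by (rule that[of "\<Union>p\<in>slit. S p"]) (use S in blast)+
qed

lemma compact_slit: "compact slit"
  unfolding slit_def by (intro compact_continuous_image continuous_intros) auto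

section \<open>One-sided limits at the slit\<close>

lemma Im_slit_quotient: "Im ((1 - h) / (1 + h)) = - 2 * Im h / (cmod (1 + h))\<^sup>2"
  by (simp add: Im_divide cmod_power2 algebra_simps)

text \<open>The quotient has imaginary part of sign opposite to that of h, which decides on which
  side of the cut \<open>csqrt\<close> is evaluated. The two sides of the slit thus receive opposite
  real values of t.\<close>

lemma t_map_half_plane:
  "Im h > 0 \<Longrightarrow> t_map h = - csqrt ((1 - h) / (1 + h))"
  "Im h < 0 \<Longrightarrow> t_map h = csqrt ((1 - h) / (1 + h))"
proof -
  let ?q = "(1 - h) / (1 + h)"
  have pos: "(cmod (1 + h))\<^sup>2 > 0" if "Im h \<noteq> 0"
    using that by (auto simp: complex_eq_iff)
  show "t_map h = - csqrt ?q" if "Im h > 0"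
  proof -
    have "Im ?q < 0"
      unfolding Im_slit_quotient using pos that by (intro divide_neg_pos) auto
    then have "csqrt (- ?q) = \<i> * csqrt ?q"
      by (intro csqrt_minus) simp
    then show ?thesis by (simp add: t_map_def)
  qed
  show "t_map h = csqrt ?q" if "Im h < 0"
  proof -
    have "Im ?q > 0"
      unfolding Im_slit_quotient using pos that by (intro divide_pos_pos) auto
    then have "csqrt (- (- ?q)) = \<i> * csqrt (- ?q)"
      by (intro csqrt_minus) simp
    then show ?thesis by (simp add: t_map_def)
  qed
qed

lemma csqrt_slit_quotient_tendsto:
  fixes v :: real
  assumes "-1 < v" "v \<le> 1"
  shows "((\<lambda>h. csqrt ((1 - h) / (1 + h))) \<longlongrightarrow> of_real (sqrt ((1 - v) / (1 + v)))) (at (of_real v))"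
proof (cases "v = 1")
  case True
  \<comment> \<open>The quotient tends to 0, an end point of the cut of \<open>csqrt\<close>; there
    the modulus alone gives the limit.\<close>
  have "((\<lambda>h. sqrt (cmod ((1 - h) / (1 + h)))) \<longlongrightarrow> sqrt (cmod ((1 - 1) / (1 + 1 :: complex)))) (at 1)"
    using slit_quotient_tendsto[of 1] by (intro tendsto_intros) simp
  then have "((\<lambda>h. cmod (csqrt ((1 - h) / (1 + h)))) \<longlongrightarrow> 0) (at 1)"
    by (simp only: norm_csqrt) simp
  then show ?thesis
    using True tendsto_norm_zero_cancel[of "\<lambda>h. csqrt ((1 - h) / (1 + h))" "at 1"] by (simp del: norm_csqrt csqrt.simps)
next
  case False
  let ?q = "(1 - complex_of_real v) / (1 + complex_of_real v)"
  define r where "r = (1 - v) / (1 + v)"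
  have "r > 0" using assms False by (simp add: r_def)
  have q: "?q = of_real r"
    by (simp add: r_def)
  have "isCont csqrt ?q"
    by (rule continuous_at_csqrt) (use \<open>r > 0\<close> in \<open>simp add: q complex_nonpos_Reals_iff\<close>)
  then have "((\<lambda>h. csqrt ((1 - h) / (1 + h))) \<longlongrightarrow> csqrt ?q) (at (of_real v))"
    using slit_quotient_tendsto[OF assms(1)] by (rule isCont_tendsto_compose)
  moreover have "csqrt ?q = of_real (sqrt r)"
    unfolding q using \<open>r > 0\<close> by (intro csqrt_of_real) simp
  ultimately show ?thesis
    by (simp add: r_def)
qed

text \<open>From either side t tends to a real number, or to infinity at -1, and \<open>f\<close> is
  real at both.\<close>

lemma boundary_limit_along:
  assumes gen: "generating_function f \<beta>\<^sub>0 \<beta>\<^sub>1" and v: "-1 \<le> v" "v \<le> 1"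
    and S: "S \<in> {{h. Im h > 0}, {h. Im h < 0}}"
  shows "\<exists>l. ((\<lambda>h. f (t_map h)) \<longlongrightarrow> l) (at (of_real v) within S) \<and> Im l = 0"
proof (cases "v = -1")
  case True
  have "filterlim t_map at_infinity (at (of_real v) within S)"
    using filterlim_mono[OF t_map_at_minus_one order_refl at_le[OF subset_UNIV]] True by simp
  then have "((\<lambda>h. f (t_map h)) \<longlongrightarrow> \<beta>\<^sub>0) (at (of_real v) within S)"
    by (rule filterlim_compose[OF generating_function_at_infinity(1)[OF gen]])
  then show ?thesis
    using generating_function_at_infinity(3)[OF gen] by blast
next
  case False
  then have v1: "-1 < v" using v by simp
  define r where "r = sqrt ((1 - v) / (1 + v))"
  have lim: "((\<lambda>h. csqrt ((1 - h) / (1 + h))) \<longlongrightarrow> of_real r) (at (of_real v) within S)"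
    using csqrt_slit_quotient_tendsto[OF v1 v(2)] tendsto_within_subset unfolding r_def by blast
  have "\<exists>t::real. (t_map \<longlongrightarrow> of_real t) (at (of_real v) within S)"
  proof (cases "S = {h. Im h > 0}")
    case True
    have "((\<lambda>h. - csqrt ((1 - h) / (1 + h))) \<longlongrightarrow> of_real (- r)) (at (of_real v) within S)"
      using tendsto_minus[OF lim] by simp
    moreover have "\<forall>\<^sub>F h in at (of_real v) within S. - csqrt ((1 - h) / (1 + h)) = t_map h"
      unfolding eventually_at_filter using True by (simp add: t_map_half_plane(1))
    ultimately show ?thesis
      using Lim_transform_eventually by blast
  next
    case False
    then have "\<forall>\<^sub>F h in at (of_real v) within S. csqrt ((1 - h) / (1 + h)) = t_map h"
      unfolding eventually_at_filter using S by (simp add: t_map_half_plane(2))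
    then show ?thesis
      using Lim_transform_eventually[OF lim] by blast
  qed
  then obtain t :: real where t: "(t_map \<longlongrightarrow> of_real t) (at (of_real v) within S)" by blast
  obtain U where U: "open U" "\<real> \<subseteq> U" "f holomorphic_on U"
    using gen unfolding generating_function_def by blast
  have "isCont f (of_real t)"
    using holomorphic_on_imp_continuous_on[OF U(3)] subsetD[OF U(2) Reals_of_real[of t]]
    by (simp add: continuous_on_eq_continuous_at[OF U(1)])
  then have "((\<lambda>h. f (t_map h)) \<longlongrightarrow> f (of_real t)) (at (of_real v) within S)"
    using t by (rule isCont_tendsto_compose)
  then show ?thesis
    using generating_function_real[OF gen] by blast
qed

lemma sheared_z_map_boundary_values:
  assumes gen: "generating_function f \<beta>\<^sub>0 \<beta>\<^sub>1" and "Im \<gamma>\<^sub>2 = 1 - \<gamma>\<^sub>1"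
  shows "boundary_values_Im_eq_v (\<lambda>h. of_real \<gamma>\<^sub>1 * z_map f h + \<gamma>\<^sub>2 * h)"
proof -
  have "\<exists>L. ((\<lambda>h. of_real \<gamma>\<^sub>1 * z_map f h + \<gamma>\<^sub>2 * h) \<longlongrightarrow> L) (at (of_real v) within S) \<and> Im L = v"
    if v: "v \<in> {-1..1}" and S: "S \<in> {{h. Im h > 0}, {h. Im h < 0}}" for v :: real and S
  proof -
    obtain l where l: "((\<lambda>h. f (t_map h)) \<longlongrightarrow> l) (at (of_real v) within S)" "Im l = 0"
      using boundary_limit_along[OF gen _ _ S, of v] v by auto
    have "((\<lambda>h. of_real \<gamma>\<^sub>1 * z_map f h + \<gamma>\<^sub>2 * h)
        \<longlongrightarrow> of_real \<gamma>\<^sub>1 * (\<i> * of_real v + l) + \<gamma>\<^sub>2 * of_real v) (at (of_real v) within S)"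
      unfolding z_map_def by (intro tendsto_intros l(1))
    \<comment> \<open>The stretched term contributes gamma1 v and \<open>\<gamma>\<^sub>2\<close>
      the missing (1 - gamma1) v.\<close>
    moreover have "Im (of_real \<gamma>\<^sub>1 * (\<i> * of_real v + l) + \<gamma>\<^sub>2 * of_real v) = v"
      by (simp add: l(2) assms(2) algebra_simps)
    ultimately show ?thesis by blast
  qed
  then show ?thesis
    unfolding boundary_values_Im_eq_v_def by blast
qed

lemma sheared_z_map_analytic:
  assumes gen: "generating_function f \<beta>\<^sub>0 \<beta>\<^sub>1"
  shows "analytic_off_slit (\<lambda>h. of_real \<gamma>\<^sub>1 * z_map f h + \<gamma>\<^sub>2 * h)"
proof -
  obtain U where U: "open U" "\<real> \<subseteq> U" "\<forall>\<^sub>F t in at_infinity. t \<in> U" "f holomorphic_on U"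
    using gen unfolding generating_function_def by blast
  obtain N where N: "open N" "slit \<subseteq> N" "t_map ` (N - slit) \<subseteq> U"
    using t_map_near_slit_open[OF U(1-3)] .
  have "(f \<circ> t_map) holomorphic_on N - slit"
    by (rule holomorphic_on_compose_gen[OF holomorphic_on_subset[OF t_map_holomorphic] U(4)])
      (use N(3) in auto)
  then have "(\<lambda>h. of_real \<gamma>\<^sub>1 * z_map f h + \<gamma>\<^sub>2 * h) holomorphic_on N - slit"
    unfolding z_map_def o_def by (intro holomorphic_intros)
  moreover have "open (N - slit)"
    using N(1) compact_slit by (simp add: open_Diff compact_imp_closed)
  ultimately show ?thesis
    unfolding analytic_off_slit_def using N(1,2) analytic_on_open by blast
qed

theorem mainTheorem10:
  fixes \<sigma>\<^sub>1 \<gamma>\<^sub>1 \<beta>\<^sub>1 :: real and \<gamma>\<^sub>2 \<beta>\<^sub>0 :: complex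
    and f z z' :: "complex \<Rightarrow> complex" and E E' bdE' :: "complex set"
  assumes "\<sigma>\<^sub>1 > 0" and "\<sigma>\<^sub>1 \<noteq> 1"
    and "generating_function f \<beta>\<^sub>0 \<beta>\<^sub>1"
    and "E = generated_inclusion f \<beta>\<^sub>0"
    and "z = z_map f"
    and "\<gamma>\<^sub>1 \<noteq> 0" and "Im \<gamma>\<^sub>2 = 1 - \<gamma>\<^sub>1"
    and "z' = (\<lambda>h. of_real \<gamma>\<^sub>1 * z h + \<gamma>\<^sub>2 * h)"
    and "bdE' = {Complex (\<gamma>\<^sub>1 * x + Re \<gamma>\<^sub>2 * y) y | x y. Complex x y \<in> frontier E}"
    and "E' = inside bdE'"
  shows "analytic_off_slit z' \<and> boundary_values_Im_eq_v z' \<and>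
    frontier E' = bdE' \<and> E_Omega_inclusion \<sigma>\<^sub>1 E'"
proof -
  note gen = assms(3)
  define c where "c = Re \<gamma>\<^sub>2"
  have "bdE' = {Complex (\<gamma>\<^sub>1 * x + c * y) y | x y. Complex x y \<in> generated_curve f \<beta>\<^sub>0}"
    using assms(4,9) frontier_generated_inclusion[OF gen] by (simp add: c_def)
  then have bd: "bdE' = circle_chart f \<beta>\<^sub>0 \<gamma>\<^sub>1 c ` sphere 0 1"
    using sheared_curve_eq_image[OF gen assms(6)] by simp
  have "frontier E' = bdE'" "E_Omega_inclusion \<sigma>\<^sub>1 E'"
    unfolding assms(10) bd by (rule circle_chart_inclusion[OF gen assms(6)])+
  moreover have "analytic_off_slit z'"
    unfolding assms(5,8) by (rule sheared_z_map_analytic[OF gen])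
  moreover have "boundary_values_Im_eq_v z'"
    unfolding assms(5,8) by (rule sheared_z_map_boundary_values[OF gen assms(7)])
  ultimately show ?thesis
    by blast
qed

end
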